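(* Let $p \in (0,1)$, and let $\sigma_p$ be the integrated density of states of the graph Laplacian for Erdős–Rényi random graphs with edge probability $p/N$ in the limit $N\to\infty$. Then $\sigma_p$ has a Lifshitz tail at the lower edge of the spectrum, $E=0$, with Lifshitz exponent $1/2$, that is, $$\lim_{E \downarrow 0} \frac{\ln \bigl|\ln[\sigma_p(E) - \sigma_p(0)]\bigr|}{\ln E} = -\frac{1}{2}.$$
   Context: Let $p>0$ be fixed. For an integer $N \ge 2$ with $N>p$, the Erdős–Rényi random graph $\mathcal{G}^{(N)}$ is the random simple graph on the vertex set $\{1,\dots,N\}$ in which each of the $\binom N2$ possible edges is present independently with probability $p/N$; $\mathbb{P}_p^{(N)}$ and $\mathbb{E}_p^{(N)}$ denote the corresponding probability measure and expectation. The graph Laplacian of $\mathcal{G}^{(N)}$ is the random $N\times N$ matrix $\Delta^{(N)} = D^{(N)} - A^{(N)}$, where $A^{(N)}$ is the adjacency matrix and $D^{(N)}$ the diagonal matrix of vertex degrees. It is symmetric and nonnegative; let $\lambda_1^{(N)},\dots,\lambda_N^{(N)}\ge 0$ be its eigenvalues, counted with multiplicity. Define the normalized mean eigenvalue counting function $$\sigma_p^{(N)}(E) := \mathbb{E}_p^{(N)}\bigl( N^{-1}\,\#\{ j \in \{1,\dots,N\} : \lambda_j^{(N)} \le E\}\bigr), \quad E\in\mathbb{R}.$$ The integrated density of states $\sigma_p:\mathbb{R}\to[0,1]$ is the (existing and unique) right-continuous distribution function such that $\sigma_p(E) = \lim_{N\to\infty}\sigma_p^{(N)}(E)$ for every continuity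 point $E$ of $\sigma_p$. *)

theory Defs
  imports "HOL-Probability.Probability" "Jordan_Normal_Form.Char_Poly"
begin

text \<open>
  A simple graph on the vertex set \<open>{1..N}\<close> is represented by its set of edges, an edge being a
  two-element set of vertices.
\<close>

definition possible_edges :: "nat \<Rightarrow> nat set set" where
  "possible_edges N = {e. e \<subseteq> {1..N} \<and> card e = 2}"

text \<open>
  \<^const>\<open>Pi_pmf\<close> makes the presence indicators of the possible edges independent; the indicator
  function is then turned into the set of edges present. The constant \<^const>\<open>bernoulli_pmf\<close> clamps
  its argument to \<open>[0, 1]\<close>, so the definition is meaningful for \<open>0 \<le> p \<le> N\<close>, \<open>N > 0\<close>.
\<close>

definition erdos_renyi :: "real \<Rightarrow> nat \<Rightarrow> nat set set pmf" where
  "erdos_renyi p N =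
     map_pmf (\<lambda>X. {e \<in> possible_edges N. X e})
       (Pi_pmf (possible_edges N) False (\<lambda>_. bernoulli_pmf (p / real N)))"

definition degree_of :: "nat set set \<Rightarrow> nat \<Rightarrow> nat" where
  "degree_of G v = card {e \<in> G. v \<in> e}"

text \<open>
  Matrix indices run from \<open>0\<close> to \<open>N - 1\<close>, so index \<open>i\<close> belongs to vertex \<open>Suc i\<close>. On the diagonal
  \<open>{Suc i, Suc i}\<close> is a singleton and hence never an edge.
\<close>

definition adjacency_matrix :: "nat \<Rightarrow> nat set set \<Rightarrow> real mat" where
  "adjacency_matrix N G = Matrix.mat N N (\<lambda>(i, j). if {Suc i, Suc j} \<in> G then 1 else 0)"

definition degree_matrix :: "nat \<Rightarrow> nat set set \<Rightarrow> real mat" where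
  "degree_matrix N G = Matrix.mat N N (\<lambda>(i, j). if i = j then real (degree_of G (Suc i)) else 0)"

definition graph_laplacian :: "nat \<Rightarrow> nat set set \<Rightarrow> real mat" where
  "graph_laplacian N G = degree_matrix N G - adjacency_matrix N G"

text \<open>
  The real eigenvalues with algebraic multiplicity. For the symmetric matrices considered here
  these are all the eigenvalues, and the two notions of multiplicity agree.
\<close>

definition eigenvalue_mset :: "real mat \<Rightarrow> real multiset" where
  "eigenvalue_mset A = proots (char_poly A)"

definition mean_counting_function :: "real \<Rightarrow> nat \<Rightarrow> real \<Rightarrow> real" where
  "mean_counting_function p N E =
     measure_pmf.expectation (erdos_renyi p N)
       (\<lambda>G. real (size {#l \<in># eigenvalue_mset (graph_laplacian N G). l \<le> E#}) / real N)"

text \<open>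
  Being the cumulative distribution function of a Borel probability measure on the real line
  comprises monotonicity, right-continuity and the limits \<open>0\<close> and \<open>1\<close> at minus and plus infinity;
  \<^const>\<open>weak_conv\<close> is convergence at every continuity point of the limit function. At most one
  function \<open>\<sigma>\<close> satisfies this predicate for given \<open>p\<close>.
\<close>

definition integrated_density_of_states :: "real \<Rightarrow> (real \<Rightarrow> real) \<Rightarrow> bool" where
  "integrated_density_of_states p \<sigma> \<longleftrightarrow>
     (\<exists>M. real_distribution M \<and> \<sigma> = cdf M) \<and>
     weak_conv (\<lambda>N. mean_counting_function p N) \<sigma>"

end

theory Submission
  imports Defs "Jordan_Normal_Form.Spectral_Radius"
begin

text \<open>
  Fix an orthonormal eigenbasis. The number of eigenvalues in an interval is the sum over all
  vertices \<open>x\<close> of the spectral mass \<open>\<Sum>j. (v j x)\<^sup>2\<close> over the eigenvectors \<open>v j\<close> involved. An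
  eigenvector for an eigenvalue \<open>l > 0\<close> has mean zero on every connected component, so by a
  Poincare inequality along a simple path it vanishes on components of size below
  \<open>1 / sqrt (2 * l)\<close>; there are therefore at most as many eigenvalues in \<open>(0, E]\<close> as vertices in
  components of size at least \<open>1 / sqrt (2 * E)\<close>. For \<open>p < 1\<close> component sizes have a
  finite exponential moment, uniformly in \<open>N\<close>, whence the upper bound
  \<open>C * exp (- B / sqrt E)\<close>. Conversely, an isolated path on \<open>n\<close> vertices has the eigenvalue
  \<open>2 - 2 * cos (pi / n) \<le> (pi / n)\<^sup>2\<close>, and a vertex starts such a path with probability at least
  exponentially small in \<open>n\<close>, which gives the lower bound \<open>exp (- A / sqrt E)\<close>. Both bounds are
  uniform in \<open>N\<close> and pass to the limit at continuity points of the integrated density of states.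
\<close>

unbundle no vec_syntax and no inner_syntax

section \<open>Spectral theorem for real symmetric matrices\<close>

lemma symmetric_mat_index:
  assumes "A\<^sup>T = A" "i < dim_row A" "j < dim_col A"
  shows "A $$ (j, i) = A $$ (i, j)"
  using assms index_transpose_mat(1)[of j A i] by (metis index_transpose_mat(3))

text \<open>Over the complex numbers an eigenvalue \<open>k\<close> always exists. Evaluating the
  Hermitian form at its eigenvector in two ways gives \<open>k * Z = cnj k * Z\<close>, where
  \<open>Z\<close> is the squared norm and non-zero. Hence \<open>k\<close> is real and is already a
  root of the real characteristic polynomial.\<close>

lemma real_symmetric_eigenvalue_exists:
  fixes A :: "real mat"
  assumes A: "A \<in> carrier_mat n n" and sym: "A\<^sup>T = A" and n: "n > 0"
  shows "\<exists>e. eigenvalue A e"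
proof -
  let ?C = "map_mat complex_of_real A"
  have C: "?C \<in> carrier_mat n n" using A by simp
  obtain k where "k \<in> spectrum ?C" using spectrum_non_empty[OF C n] by auto
  then have ev: "eigenvalue ?C k" by (simp add: spectrum_def)
  then obtain w where w: "w \<in> carrier_vec n" "w \<noteq> 0\<^sub>v n" "?C *\<^sub>v w = k \<cdot>\<^sub>v w"
    using C by (auto simp: eigenvalue_def eigenvector_def)
  have row: "(\<Sum>j<n. of_real (A $$ (i, j)) * w $ j) = k * w $ i" if "i < n" for i
  proof -
    have "(?C *\<^sub>v w) $ i = (\<Sum>j<n. of_real (A $$ (i, j)) * w $ j)"
      using that A w(1) by (auto simp: scalar_prod_def atLeast0LessThan intro!: sum.cong)
    then show ?thesis using w that by simp
  qed
  define Z where "Z = (\<Sum>i<n. cnj (w $ i) * w $ i)"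
  have "k * Z = (\<Sum>i<n. cnj (w $ i) * (k * w $ i))"
    by (simp add: Z_def sum_distrib_left mult_ac)
  also have "\<dots> = (\<Sum>i<n. cnj (w $ i) * (\<Sum>j<n. of_real (A $$ (i, j)) * w $ j))"
    by (intro sum.cong) (simp_all add: row)
  also have "\<dots> = (\<Sum>i<n. \<Sum>j<n. cnj (w $ i) * of_real (A $$ (i, j)) * w $ j)"
    by (simp add: sum_distrib_left mult_ac)
  also have "\<dots> = (\<Sum>j<n. \<Sum>i<n. cnj (w $ i) * of_real (A $$ (i, j)) * w $ j)"
    by (rule sum.swap)
  also have "\<dots> = (\<Sum>j<n. \<Sum>i<n. cnj (w $ i) * of_real (A $$ (j, i)) * w $ j)"
    using symmetric_mat_index[OF sym] A by (intro sum.cong) auto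
  also have "\<dots> = (\<Sum>j<n. w $ j * cnj (\<Sum>i<n. of_real (A $$ (j, i)) * w $ i))"
    by (simp add: sum_distrib_left mult_ac)
  also have "\<dots> = (\<Sum>j<n. w $ j * cnj (k * w $ j))"
    by (intro sum.cong) (simp_all only: row lessThan_iff)
  also have "\<dots> = cnj k * Z"
    by (simp add: Z_def sum_distrib_left mult_ac)
  finally have kZ: "k * Z = cnj k * Z" .
  have Zre: "Z = of_real (\<Sum>i<n. (cmod (w $ i))\<^sup>2)"
    unfolding Z_def of_real_sum by (intro sum.cong refl) (metis complex_norm_square mult.commute of_real_power)
  obtain i where i: "i < n" "w $ i \<noteq> 0" using w by (metis eq_vecI carrier_vecD index_zero_vec)
  have "0 < (\<Sum>i<n. (cmod (w $ i))\<^sup>2)" using i by (intro sum_pos2[of _ i]) auto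
  then have "Z \<noteq> 0" using Zre by (metis of_real_eq_0_iff less_irrefl)
  with kZ have "k = cnj k" by simp
  then obtain r where r: "k = of_real r" by (metis Reals_cases complex_cnj_complex_of_real Reals_cnj_iff)
  interpret of_real_poly: map_poly_inj_idom_hom complex_of_real ..
  have "poly (char_poly ?C) k = 0" using ev eigenvalue_root_char_poly[OF C] by simp
  then have "poly (char_poly A) r = 0"
    unfolding of_real_hom.char_poly_hom[OF A] r by (metis of_real_eq_0_iff of_real_hom.poly_map_poly)
  then show ?thesis using eigenvalue_root_char_poly[OF A] by auto
qed

text \<open>Complete \<open>v\<close> to a basis, apply Gram-Schmidt, which leaves the first vector
  unchanged, and normalise. The scalar \<open>c\<close> stays unspecified because only the direction
  of the first column matters for deflation.\<close>

lemma orthogonal_mat_with_first_col: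
  fixes v :: "real vec"
  assumes v: "v \<in> carrier_vec n" "v \<noteq> 0\<^sub>v n"
  shows "\<exists>U c. U \<in> carrier_mat n n \<and> U\<^sup>T * U = 1\<^sub>m n \<and> col U 0 = c \<cdot>\<^sub>v v"
proof -
  interpret cof_vec_space n "TYPE(real)" .
  define b where "b = basis_completion v"
  define ws where "ws = gram_schmidt n b"
  from basis_completion[OF v, folded b_def]
  have dist_b: "distinct b" and indep: "\<not> lin_dep (set b)" and b: "set b \<subseteq> carrier_vec n"
    and len_b: "length b = n" by auto
  obtain vs where bv: "b = v # vs" unfolding b_def basis_completion_def Let_def by auto
  from gram_schmidt_result[OF b dist_b indep refl, folded ws_def]
  have ws: "set ws \<subseteq> carrier_vec n" "corthogonal ws" "length ws = n" by (auto simp: len_b)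
  have hdws: "hd ws = v" using gram_schmidt_hd[OF v(1), of vs, folded bv] by (simp add: ws_def)
  have npos: "n > 0" using bv len_b by auto
  define us where "us = map (\<lambda>w. (1 / sqrt (w \<bullet> w)) \<cdot>\<^sub>v w) ws"
  define U where "U = mat_of_cols n us"
  have wc: "ws ! i \<in> carrier_vec n" if "i < n" for i using ws that by auto
  have U: "U \<in> carrier_mat n n" by (simp add: U_def us_def ws mat_of_cols_def)
  have col: "col U i = (1 / sqrt (ws ! i \<bullet> ws ! i)) \<cdot>\<^sub>v (ws ! i)" if "i < n" for i
    using that wc[OF that] unfolding U_def by (subst col_mat_of_cols) (auto simp: us_def ws)
  \<comment> \<open>\<open>corthogonal\<close> is an equivalence, so it also says that each
    \<open>ws ! i\<close> has non-zero square; this is what makes the normalisation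
    legitimate.\<close>
  have orth: "ws ! i \<bullet> ws ! j = 0 \<longleftrightarrow> i \<noteq> j" if "i < n" "j < n" for i j
    using ws(2,3) that unfolding corthogonal_def by auto
  have pos: "ws ! i \<bullet> ws ! i > 0" if "i < n" for i
  proof -
    have "ws ! i \<bullet> ws ! i \<ge> 0" by (auto simp: scalar_prod_def intro: sum_nonneg)
    then show ?thesis using orth[OF that that] by simp
  qed
  have "U\<^sup>T * U = 1\<^sub>m n"
  proof (rule eq_matI)
    fix i j assume "i < dim_row (1\<^sub>m n)" "j < dim_col (1\<^sub>m n)"
    then have ij: "i < n" "j < n" by auto
    have "(U\<^sup>T * U) $$ (i, j) = col U i \<bullet> col U j" using U ij by simp
    also have "\<dots> = (1 / sqrt (ws ! i \<bullet> ws ! i)) * ((1 / sqrt (ws ! j \<bullet> ws ! j)) * (ws ! i \<bullet> ws ! j))"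
      using wc[OF ij(1)] wc[OF ij(2)] unfolding col[OF ij(1)] col[OF ij(2)]
      by (simp only: smult_scalar_prod_distrib[of _ n] scalar_prod_smult_distrib[of _ n] smult_carrier_vec mult.left_commute)
    also have "\<dots> = 1\<^sub>m n $$ (i, j)" using ij orth[OF ij] pos[OF ij(1)] by (cases "i = j") (auto simp: field_simps)
    finally show "(U\<^sup>T * U) $$ (i, j) = 1\<^sub>m n $$ (i, j)" .
  qed (simp_all add: carrier_matD[OF U])
  moreover have "ws ! 0 = v" using hdws ws npos by (metis hd_conv_nth length_greater_0_conv)
  ultimately show ?thesis using U col[OF npos] by metis
qed

text \<open>Deflation by induction on the dimension: conjugating with an orthogonal matrix whose
  first column is an eigenvector splits off a block of size one, and the remaining symmetric block
  is diagonalised by the induction hypothesis.\<close>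

theorem real_spectral_theorem:
  fixes A :: "real mat"
  assumes "A \<in> carrier_mat n n" "A\<^sup>T = A"
  shows "\<exists>U D. U \<in> carrier_mat n n \<and> D \<in> carrier_mat n n \<and> U\<^sup>T * U = 1\<^sub>m n \<and>
           U\<^sup>T * A * U = D \<and> diagonal_mat D"
  using assms
proof (induction n arbitrary: A)
  case 0
  then show ?case by (intro exI[of _ A]) (auto simp: diagonal_mat_def)
next
  case (Suc n A)
  note A = Suc.prems(1) and sym = Suc.prems(2)
  obtain e v where ev: "eigenvector A v e"
    using real_symmetric_eigenvalue_exists[OF A sym] by (auto simp: eigenvalue_def)
  have v: "v \<in> carrier_vec (Suc n)" "v \<noteq> 0\<^sub>v (Suc n)" "A *\<^sub>v v = e \<cdot>\<^sub>v v"
    using ev A by (auto simp: eigenvector_def)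
  obtain U c where U: "U \<in> carrier_mat (Suc n) (Suc n)" "U\<^sup>T * U = 1\<^sub>m (Suc n)" "col U 0 = c \<cdot>\<^sub>v v"
    using orthogonal_mat_with_first_col[OF v(1,2)] by blast
  define B where "B = U\<^sup>T * A * U"
  have B: "B \<in> carrier_mat (Suc n) (Suc n)" using U A by (simp add: B_def)
  have UT: "U\<^sup>T \<in> carrier_mat (Suc n) (Suc n)" using U by simp
  have symB: "B\<^sup>T = B"
    unfolding B_def using U A UT sym
    by (simp add: transpose_mult[of _ "Suc n" "Suc n" _ "Suc n"] assoc_mult_mat[of _ "Suc n" "Suc n" _ "Suc n" _ "Suc n"])
  have B0: "B $$ (i, 0) = (if i = 0 then e else 0)" if i: "i < Suc n" for i
  proof -
    have "B $$ (i, 0) = (U\<^sup>T * (A * U)) $$ (i, 0)" 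
      unfolding B_def using U A UT by (simp add: assoc_mult_mat[of _ "Suc n" "Suc n" _ "Suc n" _ "Suc n"])
    also have "\<dots> = col U i \<bullet> col (A * U) 0" using U A i by simp
    also have "col (A * U) 0 = A *\<^sub>v col U 0" using U A by (intro eq_vecI) auto
    also have "\<dots> = e \<cdot>\<^sub>v col U 0" unfolding U(3) using A v 
      by (simp add: mult_mat_vec[of _ "Suc n" "Suc n"] smult_smult_assoc mult.commute)
    also have "col U i \<bullet> (e \<cdot>\<^sub>v col U 0) = e * (U\<^sup>T * U) $$ (i, 0)" using U(1) i by simp
    finally show ?thesis using i unfolding U(2) by simp
  qed
  obtain B1 B2 B3 B4 where split: "split_block B 1 1 = (B1, B2, B3, B4)" by (metis prod_cases4)
  have dB: "dim_row B = 1 + n" "dim_col B = 1 + n" using B by auto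
  note sb = split_block[OF split dB]
  \<comment> \<open>The first column of \<open>B\<close> vanishes below the corner by
    \<open>B0\<close>; symmetry carries this over to the first row.\<close>
  have B1: "B1 = mat 1 1 (\<lambda>_. e)" and B2: "B2 = 0\<^sub>m 1 n" and B3: "B3 = 0\<^sub>m n 1"
    using split B0 B symmetric_mat_index[OF symB, of 0] unfolding split_block_def Let_def by (auto intro!: eq_matI)
  have symB4: "B4\<^sup>T = B4"
  proof -
    have "B4 = mat n n (\<lambda>(i, j). B $$ (Suc i, Suc j))"
      using split B unfolding split_block_def Let_def by (auto intro!: eq_matI)
    then show ?thesis using symmetric_mat_index[OF symB] B by (auto intro!: eq_matI)
  qed
  obtain V D where V: "V \<in> carrier_mat n n" "D \<in> carrier_mat n n" "V\<^sup>T * V = 1\<^sub>m n" "V\<^sup>T * B4 * V = D" "diagonal_mat D"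
    using Suc.IH[OF sb(4) symB4] by blast
  define W where "W = four_block_mat (1\<^sub>m 1) (0\<^sub>m 1 n) (0\<^sub>m n 1) V"
  define D' where "D' = four_block_mat B1 (0\<^sub>m 1 n) (0\<^sub>m n 1) D"
  have WT: "W\<^sup>T = four_block_mat (1\<^sub>m 1) (0\<^sub>m 1 n) (0\<^sub>m n 1) V\<^sup>T"
    unfolding W_def by (subst transpose_four_block_mat[OF one_carrier_mat zero_carrier_mat zero_carrier_mat V(1)]) simp
  have W: "W \<in> carrier_mat (Suc n) (Suc n)" unfolding W_def using four_block_carrier_mat[OF one_carrier_mat[of 1] V(1)] by simp
  have D': "D' \<in> carrier_mat (Suc n) (Suc n)" unfolding D'_def using four_block_carrier_mat[OF _ V(2), of B1 1 1] B1 by simp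
  have WW: "W\<^sup>T * W = 1\<^sub>m (Suc n)"
    unfolding WT unfolding W_def using V
    by (subst mult_four_block_mat[of _ 1 1 _ n _ n _ _ 1 _ n]) (auto simp: four_block_one_mat[of 1 n, simplified])
  have V4: "V\<^sup>T * B4 \<in> carrier_mat n n" using V sb(4) by simp
  have B1c: "B1 \<in> carrier_mat 1 1" by (simp add: B1)
  have WBW: "W\<^sup>T * B * W = D'"
  proof -
    have "W\<^sup>T * B = four_block_mat B1 (0\<^sub>m 1 n) (0\<^sub>m n 1) (V\<^sup>T * B4)"
      unfolding WT sb(5) B2 B3 using V sb(4) B1c
      by (subst mult_four_block_mat[of _ 1 1 _ n _ n _ _ 1 _ n]) auto
    also have "\<dots> * W = D'"
      unfolding W_def D'_def
      using mult_four_block_mat[OF B1c zero_carrier_mat zero_carrier_mat V4 one_carrier_mat zero_carrier_mat zero_carrier_mat V(1)]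
        right_mult_zero_mat[OF V4, of 1] V(1,2,4) V4 B1c by simp
    finally show ?thesis .
  qed
  have WTc: "W\<^sup>T \<in> carrier_mat (Suc n) (Suc n)" using W by simp
  note assoc = assoc_mult_mat[of _ "Suc n" "Suc n" _ "Suc n" _ "Suc n"]
  have UW: "(U * W)\<^sup>T = W\<^sup>T * U\<^sup>T" using transpose_mult[OF U(1) W] .
  have "(U * W)\<^sup>T * (U * W) = W\<^sup>T * ((U\<^sup>T * U) * W)"
    unfolding UW using U(1) W UT WTc by (simp add: assoc)
  then have 1: "(U * W)\<^sup>T * (U * W) = 1\<^sub>m (Suc n)" using U(2) W WW by simp
  have "(U * W)\<^sup>T * A * (U * W) = W\<^sup>T * B * W"
    unfolding UW B_def using U(1) W UT WTc A by (simp add: assoc)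
  then have 2: "(U * W)\<^sup>T * A * (U * W) = D'" using WBW by simp
  have "diagonal_mat D'"
    using V(2,5) B1 unfolding diagonal_mat_def D'_def by auto
  moreover have "U * W \<in> carrier_mat (Suc n) (Suc n)" using U W by simp
  ultimately show ?case using 1 2 D' by blast
qed

text \<open>The columns of \<open>U\<close> are the eigenvectors. The first relation is their
  orthonormality. The second, completeness, is orthonormality of the rows and comes from the left
  inverse of a square matrix being a right inverse.\<close>

lemma symmetric_eigenbasis:
  fixes A :: "real mat"
  assumes A: "A \<in> carrier_mat n n" and sym: "A\<^sup>T = A"
  obtains l :: "nat \<Rightarrow> real" and v :: "nat \<Rightarrow> nat \<Rightarrow> real" where
    "\<And>j k. j < n \<Longrightarrow> k < n \<Longrightarrow> (\<Sum>i<n. v j i * v k i) = (if j = k then 1 else 0)"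
    "\<And>i k. i < n \<Longrightarrow> k < n \<Longrightarrow> (\<Sum>j<n. v j i * v j k) = (if i = k then 1 else 0)"
    "\<And>j i. j < n \<Longrightarrow> i < n \<Longrightarrow> (\<Sum>k<n. A $$ (i, k) * v j k) = l j * v j i"
    "eigenvalue_mset A = image_mset l (mset_set {..<n})"
proof -
  obtain U D where U: "U \<in> carrier_mat n n" and D: "D \<in> carrier_mat n n" and UU: "U\<^sup>T * U = 1\<^sub>m n"
    and AD: "U\<^sup>T * A * U = D" and diag: "diagonal_mat D"
    using real_spectral_theorem[OF A sym] by blast
  have UT: "U\<^sup>T \<in> carrier_mat n n" using U by simp
  note assoc = assoc_mult_mat[of _ n n _ n _ n]
  have UU': "U * U\<^sup>T = 1\<^sub>m n" using mat_mult_left_right_inverse[OF UT U UU] .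
  have "U * D = (U * U\<^sup>T) * (A * U)" unfolding AD[symmetric] using U UT A by (simp add: assoc)
  then have AU: "A * U = U * D" using UU' U A by simp
  define l where "l j = D $$ (j, j)" for j
  define v where "v j i = U $$ (i, j)" for j i
  show thesis
  proof (rule that[of v l])
    fix j k assume jk: "j < n" "k < n"
    have "(\<Sum>i<n. v j i * v k i) = (U\<^sup>T * U) $$ (j, k)"
      using jk U by (auto simp: v_def scalar_prod_def atLeast0LessThan intro!: sum.cong)
    then show "(\<Sum>i<n. v j i * v k i) = (if j = k then 1 else 0)" using UU jk by simp
    have "(\<Sum>i<n. v i j * v i k) = (U * U\<^sup>T) $$ (j, k)"
      using jk U by (auto simp: v_def scalar_prod_def atLeast0LessThan intro!: sum.cong)
    then show "(\<Sum>i<n. v i j * v i k) = (if j = k then 1 else 0)" using UU' jk by simp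
  next
    fix j i assume ji: "j < n" "i < n"
    have "(\<Sum>k<n. A $$ (i, k) * v j k) = (A * U) $$ (i, j)"
      using ji U A by (auto simp: v_def scalar_prod_def atLeast0LessThan intro!: sum.cong)
    also have "\<dots> = (\<Sum>k<n. U $$ (i, k) * D $$ (k, j))"
      unfolding AU using ji U D by (auto simp: scalar_prod_def atLeast0LessThan intro!: sum.cong)
    also have "\<dots> = (\<Sum>k<n. if k = j then U $$ (i, j) * D $$ (j, j) else 0)"
      using diag D ji by (intro sum.cong) (auto simp: diagonal_mat_def)
    also have "\<dots> = l j * v j i" using ji by (simp add: l_def v_def)
    finally show "(\<Sum>k<n. A $$ (i, k) * v j k) = l j * v j i" .
  next
    have "similar_mat_wit D A U\<^sup>T U"
      using A D U UT UU UU' AD by (intro similar_mat_witI[of _ _ n]) auto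
    then have "char_poly A = char_poly D" using char_poly_similar unfolding similar_mat_def by metis
    also have "\<dots> = (\<Prod>a\<leftarrow>diag_mat D. [:- a, 1:])"
      using diag D by (intro char_poly_upper_triangular[OF D]) (auto simp: upper_triangular_def diagonal_mat_def)
    finally have "eigenvalue_mset A = proots (\<Prod>a\<leftarrow>diag_mat D. [:- a, 1:])" by (simp add: eigenvalue_mset_def)
    also have "\<dots> = mset (diag_mat D)"
    proof -
      \<comment> \<open>Non-vanishing is carried along in the induction because roots of a product
        add up as multisets only for non-zero factors.\<close>
      have "(\<Prod>a\<leftarrow>xs. [:- a, 1:]) \<noteq> 0 \<and> proots (\<Prod>a\<leftarrow>xs. [:- a, 1:]) = mset xs" for xs :: "real list"
      proof (induction xs)
        case (Cons x xs)
        then show ?case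
          by (simp only: list.map prod_list.Cons mset.simps mult_eq_0_iff)
             (subst proots_mult, auto)
      qed simp
      then show ?thesis by blast
    qed
    also have "\<dots> = image_mset l (mset_set {..<n})"
      using D by (simp add: diag_mat_def l_def[abs_def] atLeast0LessThan[symmetric] del: atLeast0LessThan)
    finally show "eigenvalue_mset A = image_mset l (mset_set {..<n})" .
  qed
qed

section \<open>Graph Laplacian and low eigenvalues\<close>

text \<open>The Laplacian acting on functions over an arbitrary vertex type, which keeps the graph
  arguments free of matrix indices; \<open>graph_laplacian_row\<close> ties it to the
  matrix.\<close>

definition laplacian :: "'a set set \<Rightarrow> 'a set \<Rightarrow> ('a \<Rightarrow> real) \<Rightarrow> 'a \<Rightarrow> real" where
  "laplacian G V f a = (\<Sum>b | b \<in> V \<and> {a, b} \<in> G. f a - f b)"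

text \<open>The union of the connected components meeting \<open>S\<close>. Starting from a set
  rather than a single vertex lets the exploration of a random graph absorb vertices one at a
  time.\<close>

definition reach :: "'a set set \<Rightarrow> 'a set \<Rightarrow> 'a set" where
  "reach G S = {(x, y). {x, y} \<in> G}\<^sup>* `` S"

section \<open>Green's formula and a Poincare inequality on components\<close>

text \<open>Symmetrise the double sum in \<open>a\<close> and \<open>b\<close>; since no edge leaves
  \<open>C\<close>, all neighbours are inside. The division by 2 compensates for ordered pairs. Used
  with \<open>f = 1\<close> (mean zero), with \<open>f = g\<close> (energy) and with
  \<open>C = V\<close> (self-adjointness).\<close>

lemma laplacian_green:
  assumes "finite V" "C \<subseteq> V" and closed: "\<And>a b. a \<in> C \<Longrightarrow> b \<in> V \<Longrightarrow> {a, b} \<in> G \<Longrightarrow> b \<in> C"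
  shows "(\<Sum>a\<in>C. f a * laplacian G V g a) =
         (\<Sum>a\<in>C. \<Sum>b | b \<in> C \<and> {a, b} \<in> G. (f a - f b) * (g a - g b)) / 2"
proof -
  have fin: "finite C" using assms finite_subset by blast
  let ?D = "\<lambda>a b. if {a, b} \<in> G then g a - g b else 0"
  have lap: "laplacian G V g a = (\<Sum>b\<in>C. ?D a b)" if "a \<in> C" for a
  proof -
    have "{b. b \<in> V \<and> {a, b} \<in> G} = {b \<in> C. {a, b} \<in> G}" using assms that by auto
    then show ?thesis by (simp add: laplacian_def sum.inter_filter fin)
  qed
  have 1: "(\<Sum>a\<in>C. f a * laplacian G V g a) = (\<Sum>a\<in>C. \<Sum>b\<in>C. f a * ?D a b)"
    by (intro sum.cong) (simp_all add: lap sum_distrib_left)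
  have "(\<Sum>a\<in>C. \<Sum>b\<in>C. f a * ?D a b) = (\<Sum>b\<in>C. \<Sum>a\<in>C. f a * ?D a b)"
    by (rule sum.swap)
  also have "\<dots> = (\<Sum>a\<in>C. \<Sum>b\<in>C. - f b * ?D a b)"
    by (intro sum.cong) (auto simp: insert_commute algebra_simps)
  finally have "2 * (\<Sum>a\<in>C. \<Sum>b\<in>C. f a * ?D a b) = (\<Sum>a\<in>C. \<Sum>b\<in>C. f a * ?D a b) + (\<Sum>a\<in>C. \<Sum>b\<in>C. - f b * ?D a b)"
    by simp
  also have "\<dots> = (\<Sum>a\<in>C. \<Sum>b\<in>C. (f a - f b) * ?D a b)"
    by (simp add: sum.distrib[symmetric] algebra_simps)
  also have "\<dots> = (\<Sum>a\<in>C. \<Sum>b | b \<in> C \<and> {a, b} \<in> G. (f a - f b) * (g a - g b))"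
    unfolding sum.inter_filter[OF fin] by (intro sum.cong) auto
  finally show ?thesis unfolding 1 by simp
qed

text \<open>A loop created by prepending a vertex is cut out by keeping only the suffix from its
  earlier occurrence. Distinctness is what later bounds the path length by the component
  size.\<close>

lemma rtrancl_simple_path:
  assumes "(x, y) \<in> R\<^sup>*"
  obtains xs where "xs \<noteq> []" "hd xs = x" "last xs = y" "distinct xs" "successively (\<lambda>a b. (a, b) \<in> R) xs"
proof -
  have "\<exists>xs. xs \<noteq> [] \<and> hd xs = x \<and> last xs = y \<and> distinct xs \<and> successively (\<lambda>a b. (a, b) \<in> R) xs"
    using assms
  proof (induction rule: converse_rtrancl_induct)
    case base
    show ?case by (intro exI[of _ "[y]"]) auto
  next
    case (step a b)
    then obtain xs where xs: "xs \<noteq> []" "hd xs = b" "last xs = y" "distinct xs" "successively (\<lambda>a b. (a, b) \<in> R) xs"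
      by blast
    show ?case
    proof (cases "a \<in> set xs")
      case True
      then obtain ys zs where "xs = ys @ a # zs" using split_list by metis
      then show ?thesis using xs by (intro exI[of _ "a # zs"]) (auto simp: successively_append_iff)
    next
      case False
      then show ?thesis using xs step by (intro exI[of _ "a # xs"]) (auto simp: successively_Cons)
    qed
  qed
  then show ?thesis using that by blast
qed

lemma successively_in_rtrancl_image:
  assumes "successively (\<lambda>a b. (a, b) \<in> R) xs" "xs \<noteq> []" "hd xs \<in> R\<^sup>* `` S"
  shows "set xs \<subseteq> R\<^sup>* `` S"
  using assms
proof (induction xs)
  case (Cons x xs)
  then show ?case by (cases "xs = []") (auto simp: successively_Cons intro: rtrancl_into_rtrancl)
qed simp

lemma successively_nth: "successively P xs \<Longrightarrow> Suc i < length xs \<Longrightarrow> P (xs ! i) (xs ! Suc i)"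
  by (induction P xs arbitrary: i rule: successively.induct) (auto simp: nth_Cons split: nat.splits)

text \<open>Telescope along the path and apply Cauchy-Schwarz. A simple path has fewer than
  \<open>card C\<close> edges and uses each ordered pair at most once, so its squared increments are
  part of the full energy.\<close>

lemma path_difference_le_energy:
  fixes f :: "'a \<Rightarrow> real"
  assumes fin: "finite C" and xs: "xs \<noteq> []" "distinct xs" "set xs \<subseteq> C" "successively E xs"
  shows "(f (hd xs) - f (last xs))\<^sup>2 \<le> card C * (\<Sum>a\<in>C. \<Sum>b | b \<in> C \<and> E a b. (f a - f b)\<^sup>2)"
proof -
  define m where "m = length xs - 1"
  have m: "Suc m = length xs" using xs by (simp add: m_def)
  have "(\<Sum>i<m. f (xs ! i) - f (xs ! Suc i)) = f (xs ! 0) - f (xs ! m)"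
    by (induction m) auto
  then have "(f (hd xs) - f (last xs))\<^sup>2 = (\<Sum>i<m. f (xs ! i) - f (xs ! Suc i))\<^sup>2"
    using xs by (simp add: hd_conv_nth last_conv_nth m_def)
  also have "\<dots> \<le> (\<Sum>i<m. (f (xs ! i) - f (xs ! Suc i))\<^sup>2) * card {..<m}"
    by (rule sum_squared_le_sum_of_squares)
  also have "(\<Sum>i<m. (f (xs ! i) - f (xs ! Suc i))\<^sup>2) =
      (\<Sum>p\<in>(\<lambda>i. (xs ! i, xs ! Suc i)) ` {..<m}. (f (fst p) - f (snd p))\<^sup>2)"
    using xs(2) m by (subst sum.reindex) (auto simp: inj_on_def nth_eq_iff_index_eq)
  also have "\<dots> \<le> (\<Sum>p\<in>(SIGMA a:C. {b. b \<in> C \<and> E a b}). (f (fst p) - f (snd p))\<^sup>2)"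
  proof (rule sum_mono2)
    show "(\<lambda>i. (xs ! i, xs ! Suc i)) ` {..<m} \<subseteq> (SIGMA a:C. {b. b \<in> C \<and> E a b})"
      using xs(3) m successively_nth[OF xs(4)] by auto
  qed (use fin in auto)
  also have "\<dots> = (\<Sum>a\<in>C. \<Sum>b | b \<in> C \<and> E a b. (f a - f b)\<^sup>2)"
    using fin by (subst sum.Sigma) (auto simp: case_prod_beta)
  also have "real (card {..<m}) \<le> real (card C)"
  proof -
    have "length xs \<le> card C" using xs fin by (metis card_mono distinct_card)
    then show ?thesis using m by simp
  qed
  finally show ?thesis by (simp add: mult_left_mono mult_right_mono sum_nonneg mult.commute)
qed

lemma reach_closed: "a \<in> reach G S \<Longrightarrow> {a, b} \<in> G \<Longrightarrow> b \<in> reach G S"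
  unfolding reach_def by (auto intro: rtrancl_into_rtrancl)

lemma reach_refl: "S \<subseteq> reach G S"
  by (auto simp: reach_def)

lemma reach_least:
  assumes "S \<subseteq> T" "\<And>a b. a \<in> T \<Longrightarrow> {a, b} \<in> G \<Longrightarrow> b \<in> T"
  shows "reach G S \<subseteq> T"
proof -
  have "b \<in> T" if "(a, b) \<in> {(x, y). {x, y} \<in> G}\<^sup>*" "a \<in> T" for a b
    using that by (induction) (auto intro: assms(2))
  then show ?thesis using assms(1) by (auto simp: reach_def)
qed

text \<open>Let \<open>y\<close> maximise the absolute value of \<open>f\<close> on the component.
  As \<open>f\<close> has mean zero there, some \<open>z\<close> has the opposite sign or value
  zero, and the path inequality from \<open>y\<close> to \<open>z\<close> bounds
  \<open>(f y)\<^sup>2\<close> by \<open>card C\<close> times the energy, which is at most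
  \<open>2 * l * card C * (f y)\<^sup>2\<close>.\<close>

lemma eigenvalue_ge_inverse_square_component:
  fixes f :: "'a \<Rightarrow> real"
  assumes V: "finite V" "\<Union>G \<subseteq> V" and x: "x \<in> V" "f x \<noteq> 0"
    and eig: "\<And>a. a \<in> V \<Longrightarrow> laplacian G V f a = l * f a" and l: "l > 0"
  shows "1 \<le> 2 * l * (card (reach G {x}))\<^sup>2"
proof -
  define C where "C = reach G {x}"
  define R where "R = {(x, y). {x, y} \<in> G}"
  have xC: "x \<in> C" using reach_refl[of "{x}"] by (auto simp: C_def)
  have CV: "C \<subseteq> V" unfolding C_def using x V by (intro reach_least) auto
  have fin: "finite C" using CV V finite_subset by blast
  have closed: "a \<in> C \<Longrightarrow> b \<in> V \<Longrightarrow> {a, b} \<in> G \<Longrightarrow> b \<in> C" for a b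
    unfolding C_def using reach_closed by metis
  note green = laplacian_green[OF V(1) CV closed]
  define D where "D = (\<Sum>a\<in>C. \<Sum>b | b \<in> C \<and> {a, b} \<in> G. (f a - f b)\<^sup>2)"
  \<comment> \<open>Green's formula against the constant function 1 forces the eigenfunction to sum
    to zero over the component.\<close>
  have "(\<Sum>a\<in>C. 1 * laplacian G V f a) = 0" by (subst green) auto
  then have "l * (\<Sum>a\<in>C. f a) = 0" using CV eig by (simp add: sum_distrib_left subset_iff)
  then have sum0: "(\<Sum>a\<in>C. f a) = 0" using l by simp
  have "(\<Sum>a\<in>C. f a * laplacian G V f a) = D / 2"
    by (subst green) (auto simp: D_def power2_eq_square)
  moreover have "(\<Sum>a\<in>C. f a * laplacian G V f a) = l * (\<Sum>a\<in>C. (f a)\<^sup>2)"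
    unfolding sum_distrib_left using CV eig by (intro sum.cong) (auto simp: power2_eq_square)
  ultimately have D: "D = 2 * l * (\<Sum>a\<in>C. (f a)\<^sup>2)" by simp
  obtain y where y: "y \<in> C" "\<And>a. a \<in> C \<Longrightarrow> \<bar>f a\<bar> \<le> \<bar>f y\<bar>"
  proof -
    let ?M = "(\<lambda>a. \<bar>f a\<bar>) ` C"
    have "Max ?M \<in> ?M" using fin xC by (intro Max_in) auto
    then obtain y where "y \<in> C" "Max ?M = \<bar>f y\<bar>" by blast
    moreover have "\<bar>f a\<bar> \<le> Max ?M" if "a \<in> C" for a using fin that by (intro Max_ge) auto
    ultimately show thesis using that by metis
  qed
  have fy: "f y \<noteq> 0" using y(2)[OF xC] x(2) by auto
  obtain z where z: "z \<in> C" "f y * f z \<le> 0"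
  proof (rule ccontr)
    assume "\<not> thesis"
    then have "\<And>z. z \<in> C \<Longrightarrow> f y * f z > 0" using that by force
    then have "(\<Sum>z\<in>C. f y * f z) > 0" using fin xC by (intro sum_pos) auto
    then show False using sum0 by (simp add: sum_distrib_left[symmetric])
  qed
  have "sym R" by (auto simp: sym_def R_def insert_commute)
  then have "sym (R\<^sup>*)" by (rule sym_rtrancl)
  then have "(y, z) \<in> R\<^sup>*"
    using y(1) z(1) unfolding C_def reach_def R_def[symmetric]
    by (auto dest: symD intro: rtrancl_trans)
  then obtain xs where xs: "xs \<noteq> []" "hd xs = y" "last xs = z" "distinct xs" "successively (\<lambda>a b. (a, b) \<in> R) xs"
    by (rule rtrancl_simple_path)
  have "set xs \<subseteq> C"
    using successively_in_rtrancl_image[OF xs(5,1), of "{x}"] y(1) xs(2) by (auto simp: C_def reach_def R_def)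
  then have "(f y - f z)\<^sup>2 \<le> card C * D"
    using path_difference_le_energy[OF fin xs(1,4) _ xs(5), of f] xs(2,3) by (simp add: D_def R_def)
  moreover have "(f y)\<^sup>2 \<le> (f y - f z)\<^sup>2"
    using z(2) zero_le_power2[of "f z"] unfolding power2_diff by linarith
  moreover have "D \<le> 2 * l * (card C * (f y)\<^sup>2)"
  proof -
    have "(\<Sum>a\<in>C. (f a)\<^sup>2) \<le> card C * (f y)\<^sup>2"
      using y(2) by (intro sum_bounded_above) (simp add: abs_le_square_iff)
    then show ?thesis using D l by simp
  qed
  ultimately have "(f y)\<^sup>2 \<le> card C * (2 * l * (card C * (f y)\<^sup>2))"
    by (meson mult_left_mono of_nat_0_le_iff order_trans)
  then have "1 * (f y)\<^sup>2 \<le> (2 * l * (card C)\<^sup>2) * (f y)\<^sup>2"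
    by (simp add: power2_eq_square mult_ac)
  then show ?thesis using fy unfolding C_def by (simp only: mult_le_cancel_right) auto
qed

section \<open>Eigenfunctions carried by isolated paths\<close>

definition path_edges :: "'a list \<Rightarrow> 'a set set" where
  "path_edges xs = {{xs ! i, xs ! Suc i} |i. Suc i < length xs}"

text \<open>Equality rather than inclusion: every path edge is present and no other edge touches the
  path, so the entries of a non-empty \<open>xs\<close> form a whole component.\<close>

definition isolated_path :: "'a set set \<Rightarrow> 'a list \<Rightarrow> bool" where
  "isolated_path G xs \<longleftrightarrow> distinct xs \<and> {e \<in> G. e \<inter> set xs \<noteq> {}} = path_edges xs"

text \<open>
  The lowest non-constant Neumann mode \<open>cos ((k + 1 / 2) * pi / n)\<close> of the path, extended by zero.
  For distinct \<open>xs\<close> at most one summand is non-zero.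
\<close>

definition path_mode :: "'a list \<Rightarrow> 'a \<Rightarrow> real" where
  "path_mode xs a = (\<Sum>k<length xs. if xs ! k = a then cos ((2 * real k + 1) * (pi / (2 * length xs))) else 0)"

lemma path_mode_nth:
  assumes "distinct xs" "k < length xs"
  shows "path_mode xs (xs ! k) = cos ((2 * real k + 1) * (pi / (2 * length xs)))"
proof -
  have "path_mode xs (xs ! k) = (\<Sum>i<length xs. if i = k then cos ((2 * real k + 1) * (pi / (2 * length xs))) else 0)"
    unfolding path_mode_def using assms by (intro sum.cong) (auto simp: nth_eq_iff_index_eq)
  then show ?thesis using assms by simp
qed

lemma path_mode_outside: "a \<notin> set xs \<Longrightarrow> path_mode xs a = 0"
  by (auto simp: path_mode_def intro!: sum.neutral)

lemma isolated_path_edge_iff: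
  assumes iso: "isolated_path G xs" and k: "k < length xs"
  shows "{xs ! k, b} \<in> G \<longleftrightarrow> (\<exists>j<length xs. b = xs ! j \<and> (j = Suc k \<or> k = Suc j))"
proof -
  have dist: "distinct xs" using iso by (simp add: isolated_path_def)
  have "{xs ! k, b} \<in> G \<longleftrightarrow> {xs ! k, b} \<in> path_edges xs"
  proof -
    have "{e \<in> G. e \<inter> set xs \<noteq> {}} = path_edges xs" using iso by (simp add: isolated_path_def)
    moreover have "{xs ! k, b} \<inter> set xs \<noteq> {}" using k by auto
    ultimately show ?thesis by blast
  qed
  also have "\<dots> \<longleftrightarrow> (\<exists>j<length xs. b = xs ! j \<and> (j = Suc k \<or> k = Suc j))"
  proof
    assume "{xs ! k, b} \<in> path_edges xs"
    then obtain i where i: "{xs ! k, b} = {xs ! i, xs ! Suc i}" "Suc i < length xs"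
      by (auto simp: path_edges_def)
    then have "k = i \<and> b = xs ! Suc i \<or> k = Suc i \<and> b = xs ! i"
      using k dist by (auto simp: doubleton_eq_iff nth_eq_iff_index_eq)
    then show "\<exists>j<length xs. b = xs ! j \<and> (j = Suc k \<or> k = Suc j)"
      using i(2) Suc_lessD[OF i(2)] by blast
  next
    assume "\<exists>j<length xs. b = xs ! j \<and> (j = Suc k \<or> k = Suc j)"
    then show "{xs ! k, b} \<in> path_edges xs"
      using k unfolding path_edges_def by (auto simp: insert_commute)
  qed
  finally show ?thesis .
qed

text \<open>In the interior this is the addition theorem for cosine. At the two ends the cosine,
  continued by one index, repeats the value at the end vertex, so the missing neighbour contributes
  a zero difference. Vertices off the path have no neighbour on it.\<close>

lemma laplacian_path_mode:
  assumes V: "\<Union>G \<subseteq> V" and iso: "isolated_path G xs" and a: "a \<in> V"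
  shows "laplacian G V (path_mode xs) a = (2 - 2 * cos (pi / length xs)) * path_mode xs a"
proof (cases "a \<in> set xs")
  case False
  have "path_mode xs b = 0" if "{a, b} \<in> G" for b
  proof (rule path_mode_outside, rule notI)
    assume "b \<in> set xs"
    then have "{a, b} \<in> path_edges xs" using that iso by (auto simp: isolated_path_def)
    then have "a \<in> set xs" by (auto simp: path_edges_def doubleton_eq_iff)
    then show False using False by simp
  qed
  then show ?thesis using False by (auto simp: laplacian_def path_mode_outside intro!: sum.neutral)
next
  case True
  define n where "n = length xs"
  obtain k where k: "k < n" "a = xs ! k" using True by (auto simp: in_set_conv_nth n_def)
  have dist: "distinct xs" using iso by (simp add: isolated_path_def)
  define t where "t = pi / (2 * real n)"
  define c where "c r = cos ((2 * r + 1) * t)" for r :: real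
  have mode: "path_mode xs (xs ! j) = c (real j)" if "j < n" for j
    using path_mode_nth[OF dist] that by (simp add: c_def n_def t_def)
  define J where "J = {j. j < n \<and> (j = Suc k \<or> k = Suc j)}"
  have nb: "{b. b \<in> V \<and> {a, b} \<in> G} = (!) xs ` J"
  proof -
    have "b \<in> V" if "{a, b} \<in> G" for b using V that by blast
    then have "{b. b \<in> V \<and> {a, b} \<in> G} = {b. {a, b} \<in> G}" by blast
    also have "\<dots> = (!) xs ` J"
      using isolated_path_edge_iff[OF iso k(1)[unfolded n_def]] unfolding k(2) J_def n_def by auto
    finally show ?thesis .
  qed
  have inj: "inj_on ((!) xs) J" using dist by (auto simp: inj_on_def J_def n_def nth_eq_iff_index_eq)
  have "laplacian G V (path_mode xs) a = (\<Sum>j\<in>J. c (real k) - c (real j))"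
    unfolding laplacian_def nb sum.reindex[OF inj] o_def using k by (intro sum.cong) (auto simp: mode J_def)
  also have "J = (if Suc k < n then {Suc k} else {}) \<union> (if k > 0 then {k - 1} else {})"
    using k by (auto simp: J_def)
  also have "(\<Sum>j\<in>\<dots>. c (real k) - c (real j)) = (if Suc k < n then c k - c (k + 1) else 0) + (if k > 0 then c k - c (real k - 1) else 0)"
    by (subst sum.union_disjoint) (auto simp: of_nat_diff add.commute)
  \<comment> \<open>At the last vertex the phases of \<open>k\<close> and \<open>k + 1\<close> are
    \<open>pi - t\<close> and \<open>pi + t\<close>, which have equal cosines.\<close>
  also have "(if Suc k < n then c k - c (k + 1) else 0) = c k - c (k + 1)"
  proof (cases "Suc k < n")
    case False
    then have kn: "real n = real k + 1" using k by auto
    have "(2 * real k + 1) * t = pi - t" "(2 * (real k + 1) + 1) * t = pi + t"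
      using k(1) unfolding t_def kn by (auto simp: field_simps)
    then show ?thesis using False by (simp add: c_def add.commute)
  qed simp
  \<comment> \<open>At the first vertex the continued index is the real number -1; the phases are
    \<open>t\<close> and \<open>- t\<close>, and cosine is even.\<close>
  also have "(if k > 0 then c k - c (real k - 1) else 0) = c k - c (real k - 1)"
    by (auto simp: c_def)
  also have "c k - c (k + 1) + (c k - c (real k - 1)) = (2 - 2 * cos (2 * t)) * c k"
  proof -
    have "c (k + 1) = cos ((2 * real k + 1) * t + 2 * t)" "c (real k - 1) = cos ((2 * real k + 1) * t - 2 * t)"
      by (auto simp: c_def algebra_simps)
    then have "c (k + 1) + c (real k - 1) = 2 * cos (2 * t) * c k"
      by (simp add: cos_add cos_diff c_def)
    then show ?thesis by (simp add: algebra_simps)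
  qed
  finally show ?thesis using k mode[of k] by (simp add: t_def n_def)
qed

lemma two_minus_two_cos_bounds:
  assumes "n \<ge> 2"
  shows "0 < 2 - 2 * cos (pi / real n)" "2 - 2 * cos (pi / real n) \<le> (pi / n)\<^sup>2"
proof -
  have x: "0 < pi / real n" "pi / real n \<le> pi" using assms by (auto simp: field_simps)
  then have "cos (pi / real n) < cos 0" by (intro cos_monotone_0_pi) auto
  then show "0 < 2 - 2 * cos (pi / real n)" by simp
  have "2 - 2 * cos (pi / real n) = 4 * (sin (pi / real n / 2))\<^sup>2"
    using cos_double_sin[of "pi / real n / 2"] by simp
  also have "\<dots> \<le> 4 * (pi / real n / 2)\<^sup>2"
    using abs_le_square_iff[THEN iffD1, OF abs_sin_x_le_abs_x[of "pi / real n / 2"]] by simp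
  finally show "2 - 2 * cos (pi / real n) \<le> (pi / n)\<^sup>2" by (simp add: power2_eq_square)
qed

section \<open>The Laplacian matrix and its eigenbasis\<close>

lemma degree_of_eq_card_neighbours:
  assumes "G \<subseteq> possible_edges N"
  shows "degree_of G v = card {b. b \<in> {1..N} \<and> {v, b} \<in> G}"
proof -
  have "{e \<in> G. v \<in> e} = (\<lambda>b. {v, b}) ` {b. b \<in> {1..N} \<and> {v, b} \<in> G}"
  proof (intro equalityI subsetI)
    fix e assume e: "e \<in> {e \<in> G. v \<in> e}"
    then have "card e = 2" "e \<subseteq> {1..N}" using assms by (auto simp: possible_edges_def)
    then obtain a b where "e = {a, b}" by (auto simp: card_2_iff)
    then show "e \<in> (\<lambda>b. {v, b}) ` {b. b \<in> {1..N} \<and> {v, b} \<in> G}"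
      using e \<open>e \<subseteq> {1..N}\<close> by (auto simp: insert_commute)
  qed auto
  moreover have "inj_on (\<lambda>b. {v, b}) {b. b \<in> {1..N} \<and> {v, b} \<in> G}"
    by (auto simp: inj_on_def doubleton_eq_iff)
  ultimately show ?thesis unfolding degree_of_def by (simp add: card_image)
qed

lemma graph_laplacian_carrier: "graph_laplacian N G \<in> carrier_mat N N"
  by (rule carrier_matI) (simp_all add: graph_laplacian_def degree_matrix_def adjacency_matrix_def)

lemma graph_laplacian_symmetric: "(graph_laplacian N G)\<^sup>T = graph_laplacian N G"
  by (rule eq_matI) (auto simp: graph_laplacian_def degree_matrix_def adjacency_matrix_def insert_commute)

lemma graph_laplacian_row:
  assumes G: "G \<subseteq> possible_edges N" and i: "i < N"
  shows "(\<Sum>k<N. graph_laplacian N G $$ (i, k) * f (Suc k)) = laplacian G {1..N} f (Suc i)"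
proof -
  have "(\<Sum>k<N. graph_laplacian N G $$ (i, k) * f (Suc k)) =
     (\<Sum>k<N. (if k = i then real (degree_of G (Suc i)) * f (Suc i) else 0) - (if {Suc i, Suc k} \<in> G then f (Suc k) else 0))"
    using i by (intro sum.cong) (auto simp: graph_laplacian_def degree_matrix_def adjacency_matrix_def algebra_simps)
  also have "\<dots> = real (degree_of G (Suc i)) * f (Suc i) - (\<Sum>k<N. if {Suc i, Suc k} \<in> G then f (Suc k) else 0)"
    using i by (simp add: sum_subtractf)
  also have "(\<Sum>k<N. if {Suc i, Suc k} \<in> G then f (Suc k) else 0) = (\<Sum>b=1..N. if {Suc i, b} \<in> G then f b else 0)"
    by (simp add: sum.atLeast1_atMost_eq)
  also have "\<dots> = (\<Sum>b | b \<in> {1..N} \<and> {Suc i, b} \<in> G. f b)"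
    by (simp add: sum.inter_filter[symmetric])
  finally show ?thesis
    by (simp add: laplacian_def sum_subtractf degree_of_eq_card_neighbours[OF G])
qed

lemma graph_laplacian_eigenbasis:
  assumes G: "G \<subseteq> possible_edges N"
  obtains l :: "nat \<Rightarrow> real" and v :: "nat \<Rightarrow> nat \<Rightarrow> real" where
    "\<And>j. j < N \<Longrightarrow> (\<Sum>x\<in>{1..N}. (v j x)\<^sup>2) = 1"
    "\<And>x y. x \<in> {1..N} \<Longrightarrow> y \<in> {1..N} \<Longrightarrow> (\<Sum>j<N. v j x * v j y) = (if x = y then 1 else 0)"
    "\<And>j x. j < N \<Longrightarrow> x \<in> {1..N} \<Longrightarrow> laplacian G {1..N} (v j) x = l j * v j x"
    "eigenvalue_mset (graph_laplacian N G) = image_mset l (mset_set {..<N})"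
proof -
  obtain l :: "nat \<Rightarrow> real" and w :: "nat \<Rightarrow> nat \<Rightarrow> real" where w: "\<And>j k. j < N \<Longrightarrow> k < N \<Longrightarrow> (\<Sum>i<N. w j i * w k i) = (if j = k then 1 else 0)"
    "\<And>i k. i < N \<Longrightarrow> k < N \<Longrightarrow> (\<Sum>j<N. w j i * w j k) = (if i = k then 1 else 0)"
    "\<And>j i. j < N \<Longrightarrow> i < N \<Longrightarrow> (\<Sum>k<N. graph_laplacian N G $$ (i, k) * w j k) = l j * w j i"
    "eigenvalue_mset (graph_laplacian N G) = image_mset l (mset_set {..<N})"
    by (rule symmetric_eigenbasis[OF graph_laplacian_carrier graph_laplacian_symmetric]) blast
  show thesis
  proof (rule that[of "\<lambda>j x. w j (x - 1)" l])
    fix j assume j: "j < N"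
    show "(\<Sum>x\<in>{1..N}. (w j (x - 1))\<^sup>2) = 1"
      using w(1)[OF j j] by (simp add: sum.atLeast1_atMost_eq power2_eq_square)
    fix x assume "x \<in> {1..N}"
    then obtain i where i: "x = Suc i" "i < N" by (cases x) auto
    show "laplacian G {1..N} (\<lambda>x. w j (x - 1)) x = l j * w j (x - 1)"
      using graph_laplacian_row[OF G i(2), of "\<lambda>x. w j (x - 1)"] w(3)[OF j i(2)] i by simp
  next
    fix x y assume "x \<in> {1..N}" "y \<in> {1..N}"
    then show "(\<Sum>j<N. w j (x - 1) * w j (y - 1)) = (if x = y then 1 else 0)"
      by (subst w(2)) auto
  qed (rule w(4))
qed

section \<open>Counting eigenvalues by spectral mass\<close>

definition eigenvalue_count :: "nat \<Rightarrow> nat set set \<Rightarrow> real \<Rightarrow> nat" where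
  "eigenvalue_count N G E = size {#l \<in># eigenvalue_mset (graph_laplacian N G). l \<le> E#}"

lemma eigenvalue_count_diff:
  assumes "eigenvalue_mset (graph_laplacian N G) = image_mset l (mset_set {..<N})" "a \<le> b"
  shows "real (eigenvalue_count N G b) - real (eigenvalue_count N G a) = real (card {j. j < N \<and> a < l j \<and> l j \<le> b})"
proof -
  have cnt: "eigenvalue_count N G E = card {j. j < N \<and> l j \<le> E}" for E
    unfolding eigenvalue_count_def assms(1) by (simp add: filter_mset_image_mset filter_mset_mset_set)
  have "{j. j < N \<and> a < l j \<and> l j \<le> b} = {j. j < N \<and> l j \<le> b} - {j. j < N \<and> l j \<le> a}" by auto
  also have "card \<dots> = card {j. j < N \<and> l j \<le> b} - card {j. j < N \<and> l j \<le> a}"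
    using assms(2) by (intro card_Diff_subset) auto
  moreover have "card {j. j < N \<and> l j \<le> a} \<le> card {j. j < N \<and> l j \<le> b}"
    using assms(2) by (intro card_mono) auto
  ultimately show ?thesis unfolding cnt by (simp add: of_nat_diff)
qed

text \<open>All eigenvectors counted are supported on the set \<open>B\<close> of vertices in large
  components. Each has total mass 1, while completeness allows each vertex a mass of at most 1, so
  there are at most \<open>card B\<close> of them.\<close>

lemma eigenvalue_count_diff_le:
  assumes G: "G \<subseteq> possible_edges N" and ab: "0 < a" "a \<le> b"
  shows "real (eigenvalue_count N G b) - real (eigenvalue_count N G a) \<le>
         real (card {x \<in> {1..N}. 1 \<le> 2 * b * (card (reach G {x}))\<^sup>2})"
proof -
  obtain l :: "nat \<Rightarrow> real" and v :: "nat \<Rightarrow> nat \<Rightarrow> real" where v: "\<And>j. j < N \<Longrightarrow> (\<Sum>x\<in>{1..N}. (v j x)\<^sup>2) = 1"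
    "\<And>x y. x \<in> {1..N} \<Longrightarrow> y \<in> {1..N} \<Longrightarrow> (\<Sum>j<N. v j x * v j y) = (if x = y then 1 else 0)"
    "\<And>j x. j < N \<Longrightarrow> x \<in> {1..N} \<Longrightarrow> laplacian G {1..N} (v j) x = l j * v j x"
    "eigenvalue_mset (graph_laplacian N G) = image_mset l (mset_set {..<N})"
    by (rule graph_laplacian_eigenbasis[OF G]) blast
  define J where "J = {j. j < N \<and> a < l j \<and> l j \<le> b}"
  define B where "B = {x \<in> {1..N}. 1 \<le> 2 * b * (card (reach G {x}))\<^sup>2}"
  have vanish: "v j x = 0" if "j \<in> J" "x \<in> {1..N} - B" for j x
  proof (rule ccontr)
    assume nz: "v j x \<noteq> 0"
    have "1 \<le> 2 * l j * (card (reach G {x}))\<^sup>2"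
      by (rule eigenvalue_ge_inverse_square_component[of "{1..N}" _ x "v j"])
         (use G that v(3) nz ab in \<open>auto simp: possible_edges_def J_def\<close>)
    also have "\<dots> \<le> 2 * b * (card (reach G {x}))\<^sup>2"
      using that by (intro mult_right_mono) (auto simp: J_def)
    finally have "x \<in> B" using that(2) by (simp add: B_def)
    then show False using that(2) by blast
  qed
  have "real (card J) = (\<Sum>j\<in>J. \<Sum>x\<in>{1..N}. (v j x)\<^sup>2)"
    using v(1) by (simp add: J_def)
  also have "\<dots> = (\<Sum>j\<in>J. \<Sum>x\<in>B. (v j x)\<^sup>2)"
    using vanish by (intro sum.cong sum.mono_neutral_right) (auto simp: B_def)
  also have "\<dots> = (\<Sum>x\<in>B. \<Sum>j\<in>J. (v j x)\<^sup>2)" by (rule sum.swap)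
  also have "\<dots> \<le> (\<Sum>x\<in>B. \<Sum>j<N. (v j x)\<^sup>2)"
    by (intro sum_mono sum_mono2) (auto simp: J_def)
  also have "\<dots> = real (card B)"
    using v(2) by (simp add: B_def power2_eq_square)
  finally show ?thesis
    unfolding eigenvalue_count_diff[OF v(4) ab(2)] J_def B_def .
qed

text \<open>An explicit eigenfunction \<open>u\<close> forces spectral mass at \<open>x\<close>: its
  coefficients \<open>c j\<close> vanish unless \<open>l j = m\<close>, so Cauchy-Schwarz on the
  expansion of \<open>u x\<close> together with Parseval gives the bound. Multiplicities of
  \<open>m\<close> need no separate treatment.\<close>

lemma spectral_mass_ge:
  fixes v :: "nat \<Rightarrow> 'a \<Rightarrow> real"
  assumes V: "finite V"
    and compl: "\<And>x y. x \<in> V \<Longrightarrow> y \<in> V \<Longrightarrow> (\<Sum>j<N. v j x * v j y) = (if x = y then 1 else 0)"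
    and eig: "\<And>j x. j < N \<Longrightarrow> x \<in> V \<Longrightarrow> laplacian G V (v j) x = l j * v j x"
    and u: "\<And>x. x \<in> V \<Longrightarrow> laplacian G V u x = m * u x"
    and x: "x \<in> V"
  shows "(u x)\<^sup>2 \<le> (\<Sum>y\<in>V. (u y)\<^sup>2) * (\<Sum>j | j < N \<and> l j = m. (v j x)\<^sup>2)"
proof -
  define c where "c j = (\<Sum>y\<in>V. u y * v j y)" for j
  define J where "J = {j. j < N \<and> l j = m}"
  have c0: "c j = 0" if "j \<in> {..<N} - J" for j
  proof -
    have "l j * c j = (\<Sum>y\<in>V. u y * laplacian G V (v j) y)"
      using eig that by (simp add: c_def sum_distrib_left mult_ac)
    \<comment> \<open>Self-adjointness: the right-hand side of Green's formula is symmetric in the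
      two functions.\<close>
    also have "\<dots> = (\<Sum>y\<in>V. v j y * laplacian G V u y)"
    proof -
      have "(\<Sum>y\<in>V. f y * laplacian G V g y) =
          (\<Sum>a\<in>V. \<Sum>b | b \<in> V \<and> {a, b} \<in> G. (f a - f b) * (g a - g b)) / 2" for f g
        by (rule laplacian_green[OF V order.refl])
      from this[of u "v j"] this[of "v j" u] show ?thesis by (simp only: mult.commute)
    qed
    also have "\<dots> = m * c j"
      using u by (simp add: c_def sum_distrib_left mult_ac)
    finally show ?thesis using that by (auto simp: J_def)
  qed
  have expand: "u x = (\<Sum>j<N. c j * v j x)" if "x \<in> V" for x
  proof -
    have "(\<Sum>j<N. c j * v j x) = (\<Sum>y\<in>V. \<Sum>j<N. u y * (v j y * v j x))"
      unfolding c_def sum_distrib_right mult.assoc by (rule sum.swap)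
    also have "\<dots> = (\<Sum>y\<in>V. u y * (\<Sum>j<N. v j y * v j x))" by (simp add: sum_distrib_left)
    also have "\<dots> = (\<Sum>y\<in>V. if y = x then u y else 0)" using that compl by (intro sum.cong) auto
    finally show ?thesis using that V by simp
  qed
  have parseval: "(\<Sum>y\<in>V. (u y)\<^sup>2) = (\<Sum>j<N. (c j)\<^sup>2)"
  proof -
    have "(\<Sum>y\<in>V. (u y)\<^sup>2) = (\<Sum>y\<in>V. \<Sum>j<N. c j * (u y * v j y))"
    proof (intro sum.cong refl)
      fix y assume "y \<in> V"
      then have "(u y)\<^sup>2 = u y * (\<Sum>j<N. c j * v j y)"
        using expand[of y] by (simp add: power2_eq_square)
      then show "(u y)\<^sup>2 = (\<Sum>j<N. c j * (u y * v j y))" by (simp add: sum_distrib_left mult_ac)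
    qed
    also have "\<dots> = (\<Sum>j<N. \<Sum>y\<in>V. c j * (u y * v j y))" by (rule sum.swap)
    finally show ?thesis by (simp add: c_def sum_distrib_left power2_eq_square)
  qed
  have "u x = (\<Sum>j\<in>J. c j * v j x)"
    unfolding expand[OF x] using c0 by (intro sum.mono_neutral_right) (auto simp: J_def)
  then have "(u x)\<^sup>2 \<le> (\<Sum>j\<in>J. (c j)\<^sup>2) * (\<Sum>j\<in>J. (v j x)\<^sup>2)"
    using Cauchy_Schwarz_ineq_sum[of c "\<lambda>j. v j x" J] by simp
  also have "\<dots> \<le> (\<Sum>j<N. (c j)\<^sup>2) * (\<Sum>j\<in>J. (v j x)\<^sup>2)"
    by (intro mult_right_mono sum_mono2 sum_nonneg) (auto simp: J_def)
  finally show ?thesis unfolding parseval J_def .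
qed

text \<open>At the first vertex of an isolated path the mode has square at least 1/2, and its
  squared norm is at most \<open>n\<close>. Each starting vertex thus carries mass at least
  \<open>1 / (2 * n)\<close> in the eigenspace, whose dimension is the total mass.\<close>

lemma eigenvalue_count_diff_ge:
  assumes G: "G \<subseteq> possible_edges N" and n: "n \<ge> 2"
    and ab: "a < 2 - 2 * cos (pi / n)" "2 - 2 * cos (pi / n) \<le> b"
  shows "real (card {x \<in> {1..N}. \<exists>xs. isolated_path G xs \<and> length xs = n \<and> hd xs = x}) / (2 * real n) \<le>
         real (eigenvalue_count N G b) - real (eigenvalue_count N G a)"
proof -
  define m where "m = 2 - 2 * cos (pi / n)"
  obtain l :: "nat \<Rightarrow> real" and v :: "nat \<Rightarrow> nat \<Rightarrow> real" where v: "\<And>j. j < N \<Longrightarrow> (\<Sum>x\<in>{1..N}. (v j x)\<^sup>2) = 1"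
    "\<And>x y. x \<in> {1..N} \<Longrightarrow> y \<in> {1..N} \<Longrightarrow> (\<Sum>j<N. v j x * v j y) = (if x = y then 1 else 0)"
    "\<And>j x. j < N \<Longrightarrow> x \<in> {1..N} \<Longrightarrow> laplacian G {1..N} (v j) x = l j * v j x"
    "eigenvalue_mset (graph_laplacian N G) = image_mset l (mset_set {..<N})"
    by (rule graph_laplacian_eigenbasis[OF G]) blast
  have GV: "\<Union>G \<subseteq> {1..N}" using G by (auto simp: possible_edges_def)
  define J where "J = {j. j < N \<and> l j = m}"
  define B where "B = {x \<in> {1..N}. \<exists>xs. isolated_path G xs \<and> length xs = n \<and> hd xs = x}"
  have mass: "1 / (2 * real n) \<le> (\<Sum>j\<in>J. (v j x)\<^sup>2)" if x: "x \<in> B" for x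
  proof -
    obtain xs where xs: "isolated_path G xs" "length xs = n" "hd xs = x" using x by (auto simp: B_def)
    have dist: "distinct xs" using xs by (simp add: isolated_path_def)
    have x0: "x = xs ! 0" using xs n by (subst hd_conv_nth[symmetric]) auto
    let ?u = "path_mode xs"
    have ux: "1 / 2 \<le> (?u x)\<^sup>2"
    proof -
      \<comment> \<open>Since \<open>n\<close> is at least 2, the phase at the first vertex is at
        most \<open>pi / 4\<close>.\<close>
      have "cos (pi / 4) \<le> cos (pi / (2 * real n))"
        using n by (intro cos_monotone_0_pi_le) (auto simp: field_simps)
      then have "sqrt 2 / 2 \<le> ?u x"
        using path_mode_nth[OF dist, of 0] n xs(2) by (simp add: x0 cos_45)
      then have "(sqrt 2 / 2)\<^sup>2 \<le> (?u x)\<^sup>2" by (intro power_mono) auto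
      then show ?thesis by (simp add: power_divide)
    qed
    have le1: "(?u y)\<^sup>2 \<le> 1" for y
    proof (cases "y \<in> set xs")
      case True
      then obtain k where "k < length xs" "y = xs ! k" by (auto simp: in_set_conv_nth)
      then show ?thesis using path_mode_nth[OF dist] by (simp add: abs_square_le_1)
    qed (simp add: path_mode_outside)
    have "(\<Sum>y\<in>{1..N}. (?u y)\<^sup>2) = (\<Sum>y\<in>{1..N} \<inter> set xs. (?u y)\<^sup>2)"
      by (rule sum.mono_neutral_right) (auto simp: path_mode_outside)
    also have "\<dots> \<le> real (card ({1..N} \<inter> set xs)) * 1"
      by (intro sum_bounded_above le1)
    also have "\<dots> \<le> n"
      using card_mono[of "set xs" "{1..N} \<inter> set xs"] distinct_card[OF dist] xs(2) by simp
    finally have un: "(\<Sum>y\<in>{1..N}. (?u y)\<^sup>2) \<le> n" .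
    have "(?u x)\<^sup>2 \<le> (\<Sum>y\<in>{1..N}. (?u y)\<^sup>2) * (\<Sum>j\<in>J. (v j x)\<^sup>2)"
      unfolding J_def
      by (rule spectral_mass_ge[OF _ v(2,3)]) (use laplacian_path_mode[OF GV xs(1)] xs(2) x in \<open>auto simp: m_def B_def\<close>)
    also have "\<dots> \<le> n * (\<Sum>j\<in>J. (v j x)\<^sup>2)"
      by (intro mult_right_mono un sum_nonneg) auto
    finally have "1 / 2 \<le> n * (\<Sum>j\<in>J. (v j x)\<^sup>2)" using ux by simp
    then show ?thesis using n by (simp add: field_simps)
  qed
  have "real (card B) / (2 * real n) = (\<Sum>x\<in>B. 1 / (2 * real n))" by simp
  also have "\<dots> \<le> (\<Sum>x\<in>B. \<Sum>j\<in>J. (v j x)\<^sup>2)" by (intro sum_mono mass)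
  also have "\<dots> \<le> (\<Sum>x\<in>{1..N}. \<Sum>j\<in>J. (v j x)\<^sup>2)"
    by (intro sum_mono2 sum_nonneg) (auto simp: B_def)
  also have "\<dots> = (\<Sum>j\<in>J. \<Sum>x\<in>{1..N}. (v j x)\<^sup>2)" by (rule sum.swap)
  also have "\<dots> = real (card J)" using v(1) by (simp add: J_def)
  also have "\<dots> \<le> real (card {j. j < N \<and> a < l j \<and> l j \<le> b})"
    using ab by (intro of_nat_mono card_mono) (auto simp: J_def m_def)
  also have "\<dots> = real (eigenvalue_count N G b) - real (eigenvalue_count N G a)"
    using ab by (intro eigenvalue_count_diff[OF v(4), symmetric]) auto
  finally show ?thesis unfolding B_def .
qed

section \<open>Random graphs\<close>

text \<open>A general ground set \<open>F\<close> in place of all possible edges makes induction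
  over single edges possible.\<close>

definition random_subset :: "real \<Rightarrow> 'a set \<Rightarrow> 'a set pmf" where
  "random_subset q F = map_pmf (\<lambda>X. {e \<in> F. X e}) (Pi_pmf F False (\<lambda>_. bernoulli_pmf q))"

lemma erdos_renyi_eq_random_subset: "erdos_renyi p N = random_subset (p / N) (possible_edges N)"
  by (simp add: erdos_renyi_def random_subset_def)

lemma set_random_subset: "set_pmf (random_subset q F) \<subseteq> Pow F"
  by (auto simp: random_subset_def)

lemma integrable_random_subset:
  fixes f :: "'a set \<Rightarrow> real"
  assumes "finite F"
  shows "integrable (measure_pmf (random_subset q F)) f"
proof (rule integrable_measure_pmf_finite)
  show "finite (set_pmf (random_subset q F))"
    using set_random_subset[of q F] assms by (meson finite_Pow_iff finite_subset)
qed

lemma expectation_random_subset_mono: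
  fixes f g :: "'a set \<Rightarrow> real"
  assumes "finite F" "\<And>G. G \<subseteq> F \<Longrightarrow> f G \<le> g G"
  shows "measure_pmf.expectation (random_subset q F) f \<le> measure_pmf.expectation (random_subset q F) g"
  using assms set_random_subset[of q F]
  by (intro integral_mono_AE integrable_random_subset) (auto simp: AE_measure_pmf_iff)

lemma random_subset_insert:
  assumes "finite F" "e \<notin> F"
  shows "random_subset q (insert e F) =
    bernoulli_pmf q \<bind> (\<lambda>y. map_pmf (\<lambda>G. if y then insert e G else G) (random_subset q F))"
proof -
  have "{x. (x = e \<or> x \<in> F) \<and> (f(e := y)) x} = (if y then insert e {x \<in> F. f x} else {x \<in> F. f x})" for f y
    using assms(2) by auto
  then show ?thesis
    unfolding random_subset_def using assms
    by (simp add: Pi_pmf_insert' map_bind_pmf map_pmf_def bind_assoc_pmf bind_return_pmf)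
qed

text \<open>Conditioning on the state of one element, which is independent of the rest; this is the
  recursion that drives the exploration argument.\<close>

lemma expectation_random_subset_insert:
  fixes f :: "'a set \<Rightarrow> real"
  assumes F: "finite F" "e \<notin> F" and q: "0 \<le> q" "q \<le> 1"
  shows "measure_pmf.expectation (random_subset q (insert e F)) f =
    q * measure_pmf.expectation (random_subset q F) (\<lambda>G. f (insert e G)) +
    (1 - q) * measure_pmf.expectation (random_subset q F) f"
proof -
  have fin: "finite (set_pmf (random_subset q F))"
    using set_random_subset[of q F] F by (meson finite_Pow_iff finite_subset)
  have "measure_pmf.expectation (random_subset q (insert e F)) f =
    (\<Sum>y\<in>UNIV. pmf (bernoulli_pmf q) y *\<^sub>R
      measure_pmf.expectation (map_pmf (\<lambda>G. if y then insert e G else G) (random_subset q F)) f)"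
    unfolding random_subset_insert[OF F] using fin by (intro pmf_expectation_bind) auto
  then show ?thesis using q by (simp add: UNIV_bool)
qed

section \<open>Exponential moments of component sizes\<close>

lemma reach_insert_edge:
  assumes "s \<in> S"
  shows "reach (insert {s, t} G) S \<subseteq> reach G (insert t S)"
proof (rule reach_least)
  show "S \<subseteq> reach G (insert t S)" using reach_refl[of "insert t S" G] by auto
  fix a b assume a: "a \<in> reach G (insert t S)" "{a, b} \<in> insert {s, t} G"
  then show "b \<in> reach G (insert t S)"
    using reach_refl[of "insert t S" G] assms reach_closed[of a G "insert t S" b]
    by (auto simp: doubleton_eq_iff)
qed

lemma finite_reach: "finite V \<Longrightarrow> \<Union>G \<subseteq> V \<Longrightarrow> S \<subseteq> V \<Longrightarrow> finite (reach G S)"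
  by (rule finite_subset[of _ V], rule reach_least) auto

text \<open>
  Edges are revealed one at a time at the boundary of the set \<open>S\<close> reached so far. In the bound,
  every vertex of \<open>S\<close> carries the factor \<open>z\<close> and a factor \<open>b\<close> for each of its unrevealed boundary
  edges: revealing one removes a factor \<open>b\<close> and, with probability \<open>q\<close>, adds a vertex of weight at
  most \<open>w\<close>, so that the choice \<open>b = 1 - q + q * w\<close> balances the two.
\<close>

lemma expectation_power_card_reach_le:
  fixes z q w b :: real and F :: "'a set set"
  assumes V: "finite V" "\<Union>F \<subseteq> V" "S \<subseteq> V" "finite F"
    and q: "0 \<le> q" "q \<le> 1" and z: "1 \<le> z" and w: "1 \<le> w"
    and b: "b = 1 + q * (w - 1)" and zb: "z * b ^ n \<le> w"
    and deg: "\<And>v. card {t. {v, t} \<in> F} \<le> n"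
  shows "measure_pmf.expectation (random_subset q F) (\<lambda>G. z ^ card (reach G S))
           \<le> (\<Prod>s\<in>S. z * b ^ card {t. t \<notin> S \<and> {s, t} \<in> F})"
  using V deg
\<comment> \<open>\<open>S\<close> has to vary: when the revealed edge is present, \<open>F\<close>
  loses an edge while the start set gains the vertex \<open>t\<close>.\<close>
proof (induction "card F" arbitrary: F S)
  case 0
  then have "F = {}" by simp
  have "measure_pmf.expectation (random_subset q F) (\<lambda>G. z ^ card (reach G S)) \<le> measure_pmf.expectation (random_subset q F) (\<lambda>G. z ^ card S)"
  proof (rule expectation_random_subset_mono)
    fix G assume "G \<subseteq> F"
    then have "reach G S \<subseteq> S" using \<open>F = {}\<close> by (intro reach_least) auto
    then show "z ^ card (reach G S) \<le> z ^ card S"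
      using z 0 finite_subset by (intro power_increasing card_mono) auto
  qed (use 0 in auto)
  then show ?case using \<open>F = {}\<close> by simp
next
  case (Suc k F S)
  have finS: "finite S" using Suc.prems finite_subset by blast
  have b1: "1 \<le> b" using q w b by simp
  show ?case
  proof (cases "\<exists>s t. s \<in> S \<and> t \<notin> S \<and> {s, t} \<in> F")
    \<comment> \<open>No edge of \<open>F\<close> leaves \<open>S\<close>, so nothing further can be
      reached and every exponent of \<open>b\<close> is zero.\<close>
    case False
    have "measure_pmf.expectation (random_subset q F) (\<lambda>G. z ^ card (reach G S)) \<le> measure_pmf.expectation (random_subset q F) (\<lambda>G. z ^ card S)"
    proof (rule expectation_random_subset_mono)
      fix G assume "G \<subseteq> F"
      then have "reach G S \<subseteq> S" using False by (intro reach_least) auto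
      then show "z ^ card (reach G S) \<le> z ^ card S"
        using z finS by (intro power_increasing card_mono) auto
    qed (use Suc in auto)
    also have "\<dots> = (\<Prod>s\<in>S. z)" by simp
    also have "\<dots> = (\<Prod>s\<in>S. z * b ^ card {t. t \<notin> S \<and> {s, t} \<in> F})"
    proof (rule prod.cong[OF refl])
      fix s assume "s \<in> S"
      then have "{t. t \<notin> S \<and> {s, t} \<in> F} = {}" using False by blast
      then show "z = z * b ^ card {t. t \<notin> S \<and> {s, t} \<in> F}" by (simp only: card.empty) simp
    qed
    finally show ?thesis .
  next
    case True
    then obtain s t where st: "s \<in> S" "t \<notin> S" "{s, t} \<in> F" by blast
    define F' where "F' = F - {{s, t}}"
    have F': "F = insert {s, t} F'" "{s, t} \<notin> F'" "finite F'" "\<Union>F' \<subseteq> V" "k = card F'"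
      using st Suc.prems Suc.hyps by (auto simp: F'_def)
    have tV: "t \<in> V" using st Suc.prems by auto
    have nbfin: "finite {u. {v, u} \<in> F}" for v
      by (rule finite_subset[of _ V]) (use Suc.prems in auto)
    have deg': "card {u. {v, u} \<in> F'} \<le> n" for v
      using card_mono[OF nbfin[of v], of "{u. {v, u} \<in> F'}"] Suc.prems(5)[of v] F'(1) by fastforce
    define c where "c u = card {x. x \<notin> S \<and> {u, x} \<in> F'}" for u
    define P where "P = (\<Prod>u\<in>S. z * b ^ c u)"
    have P0: "0 \<le> P" unfolding P_def using z b1 by (intro prod_nonneg) auto
    have 1: "measure_pmf.expectation (random_subset q F') (\<lambda>G. z ^ card (reach G S)) \<le> P"
      unfolding P_def c_def using F' Suc.prems deg' by (intro Suc.hyps) auto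
    have "measure_pmf.expectation (random_subset q F') (\<lambda>G. z ^ card (reach (insert {s, t} G) S))
        \<le> measure_pmf.expectation (random_subset q F') (\<lambda>G. z ^ card (reach G (insert t S)))"
    proof (rule expectation_random_subset_mono)
      fix G assume "G \<subseteq> F'"
      then have "finite (reach G (insert t S))"
        using F' Suc.prems tV by (intro finite_reach[of V]) auto
      then show "z ^ card (reach (insert {s, t} G) S) \<le> z ^ card (reach G (insert t S))"
        using z reach_insert_edge[OF st(1)] by (intro power_increasing card_mono) auto
    qed (use F' in auto)
    also have "\<dots> \<le> (\<Prod>u\<in>insert t S. z * b ^ card {x. x \<notin> insert t S \<and> {u, x} \<in> F'})"
      using F' Suc.prems deg' tV by (intro Suc.hyps) auto
    also have "\<dots> = (z * b ^ card {x. x \<notin> insert t S \<and> {t, x} \<in> F'}) *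
        (\<Prod>u\<in>S. z * b ^ card {x. x \<notin> insert t S \<and> {u, x} \<in> F'})"
      using finS st by simp
    \<comment> \<open>The new vertex \<open>t\<close> has at most \<open>n\<close> boundary edges
      and so weighs at most \<open>z * b ^ n\<close>; for the old vertices, adding \<open>t\<close>
      to the start set can only remove boundary edges.\<close>
    also have "\<dots> \<le> w * P"
      unfolding P_def
    proof (rule mult_mono)
      have fin': "finite {u. {v, u} \<in> F'}" for v
        using nbfin[of v] F' by (auto elim: finite_subset[rotated])
      have "card {x. x \<notin> insert t S \<and> {t, x} \<in> F'} \<le> n"
        using card_mono[OF fin'[of t], of "{x. x \<notin> insert t S \<and> {t, x} \<in> F'}"] deg'[of t] by fastforce
      then have "z * b ^ card {x. x \<notin> insert t S \<and> {t, x} \<in> F'} \<le> z * b ^ n"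
        using z b1 by (intro mult_left_mono power_increasing) auto
      then show "z * b ^ card {x. x \<notin> insert t S \<and> {t, x} \<in> F'} \<le> w" using zb by simp
      have "card {x. x \<notin> insert t S \<and> {u, x} \<in> F'} \<le> c u" for u
        unfolding c_def using fin'[of u] by (intro card_mono) (auto elim: finite_subset[rotated])
      then show "(\<Prod>u\<in>S. z * b ^ card {x. x \<notin> insert t S \<and> {u, x} \<in> F'}) \<le> (\<Prod>u\<in>S. z * b ^ c u)"
        using z b1 by (intro prod_mono conjI mult_left_mono power_increasing) auto
    qed (use z b1 w in \<open>auto intro!: prod_nonneg mult_nonneg_nonneg\<close>)
    finally have 2: "measure_pmf.expectation (random_subset q F') (\<lambda>G. z ^ card (reach (insert {s, t} G) S)) \<le> w * P" .
    have "measure_pmf.expectation (random_subset q F) (\<lambda>G. z ^ card (reach G S)) \<le> q * (w * P) + (1 - q) * P"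
      unfolding F'(1) expectation_random_subset_insert[OF F'(3,2) q]
      using 1 2 q by (intro add_mono mult_left_mono) auto
    also have "\<dots> = b * P" by (simp add: b algebra_simps)
    \<comment> \<open>Compared with \<open>F'\<close>, only the boundary count of \<open>s\<close>
      changes, by the single edge to \<open>t\<close>; this accounts for the extra factor
      \<open>b\<close>.\<close>
    also have "\<dots> = (\<Prod>u\<in>S. z * b ^ card {x. x \<notin> S \<and> {u, x} \<in> F})"
    proof -
      have other: "card {x. x \<notin> S \<and> {u, x} \<in> F} = c u" if "u \<in> S - {s}" for u
      proof -
        have "{x. x \<notin> S \<and> {u, x} \<in> F} = {x. x \<notin> S \<and> {u, x} \<in> F'}"
          using that st by (auto simp: F'(1) doubleton_eq_iff)
        then show ?thesis by (simp add: c_def)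
      qed
      have "{x. x \<notin> S \<and> {s, x} \<in> F} = insert t {x. x \<notin> S \<and> {s, x} \<in> F'}"
        using st by (auto simp: F'(1) doubleton_eq_iff)
      moreover have "finite {x. x \<notin> S \<and> {s, x} \<in> F'}"
        using nbfin[of s] F'(1) by (auto elim!: finite_subset[rotated])
      ultimately have self: "card {x. x \<notin> S \<and> {s, x} \<in> F} = Suc (c s)"
        using F'(2) by (simp add: c_def)
      have "(\<Prod>u\<in>S. z * b ^ card {x. x \<notin> S \<and> {u, x} \<in> F}) =
          (z * b ^ Suc (c s)) * (\<Prod>u\<in>S - {s}. z * b ^ c u)"
        unfolding prod.remove[OF finS st(1)] self using other by simp
      also have "\<dots> = b * P" unfolding P_def prod.remove[OF finS st(1)] by simp
      finally show ?thesis ..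
    qed
    finally show ?thesis .
  qed
qed

lemma finite_possible_edges: "finite (possible_edges N)"
  by (rule finite_subset[of _ "Pow {1..N}"]) (auto simp: possible_edges_def)

text \<open>The tangent to \<open>ln\<close> at 1 lies strictly above it away from 1. This is where
  subcriticality enters: at \<open>p = 1\<close> the rate would equal 1 and give no decay.\<close>

lemma subcritical_growth_rate:
  fixes p :: real
  assumes "0 < p" "p < 1"
  shows "1 < exp (p - 1) / p"
proof -
  have "ln p < p - 1" using assms ln_less_self[of p] by (metis ln_eq_minus_one ln_le_minus_one less_eq_real_def less_irrefl)
  then have "exp (ln p) < exp (p - 1)" by simp
  then show ?thesis using assms by simp
qed

text \<open>
  The choice \<open>w = 1 / p\<close> maximises the admissible rate \<open>z = w * exp (- p * (w - 1))\<close>.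
\<close>

lemma expectation_power_component_le:
  assumes p: "0 < p" "p < 1" and N: "0 < N" and x: "x \<in> {1..N}"
  shows "measure_pmf.expectation (erdos_renyi p N) (\<lambda>G. (exp (p - 1) / p) ^ card (reach G {x})) \<le> 1 / p"
proof -
  define z where "z = exp (p - 1) / p"
  \<comment> \<open>This is \<open>1 + q * (w - 1)\<close> for \<open>q = p / N\<close> and
    \<open>w = 1 / p\<close>. With the degree bound \<open>n = N\<close>, the estimate of
    \<open>1 + x\<close> by \<open>exp x\<close> makes \<open>z * b ^ N\<close> at most
    \<open>1 / p\<close>.\<close>
  define b where "b = 1 + (1 - p) / N"
  have z: "1 < z" using subcritical_growth_rate[OF p] by (simp add: z_def)
  have b1: "1 \<le> b" using p by (simp add: b_def)
  have "b ^ N \<le> exp ((1 - p) / N) ^ N"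
    unfolding b_def using p by (intro power_mono) auto
  also have "\<dots> = exp (1 - p)" using N by (simp add: exp_of_nat_mult[symmetric])
  finally have "z * b ^ N \<le> z * exp (1 - p)" using z by simp
  also have "\<dots> = 1 / p" by (simp add: z_def exp_add[symmetric])
  finally have zb: "z * b ^ N \<le> 1 / p" .
  have deg: "card {t. {v, t} \<in> possible_edges N} \<le> N" for v
  proof -
    have "{t. {v, t} \<in> possible_edges N} \<subseteq> {1..N}" by (auto simp: possible_edges_def)
    then have "card {t. {v, t} \<in> possible_edges N} \<le> card {1..N}" by (intro card_mono) auto
    then show ?thesis by simp
  qed
  have pN: "p / N \<le> 1" using p N by (simp add: field_simps)
  have "measure_pmf.expectation (random_subset (p / N) (possible_edges N)) (\<lambda>G. z ^ card (reach G {x}))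
     \<le> (\<Prod>s\<in>{x}. z * b ^ card {t. t \<notin> {x} \<and> {s, t} \<in> possible_edges N})"
    by (rule expectation_power_card_reach_le[where V = "{1..N}" and w = "1 / p" and n = N])
       (use x p z N finite_possible_edges zb deg pN in \<open>auto simp: possible_edges_def b_def field_simps\<close>)
  also have "\<dots> \<le> z * b ^ N"
  proof -
    have "{t. t \<notin> {x} \<and> {x, t} \<in> possible_edges N} \<subseteq> {1..N}" by (auto simp: possible_edges_def)
    then have "card {t. t \<notin> {x} \<and> {x, t} \<in> possible_edges N} \<le> card {1..N}" by (intro card_mono) auto
    then show ?thesis using z b1 by (auto intro!: power_increasing)
  qed
  finally show ?thesis using zb unfolding erdos_renyi_eq_random_subset z_def by simp
qed

section \<open>Upper bound for the mean counting function\<close>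

lemma mean_counting_function_diff:
  "mean_counting_function p N b - mean_counting_function p N a =
   measure_pmf.expectation (erdos_renyi p N)
     (\<lambda>G. (real (eigenvalue_count N G b) - real (eigenvalue_count N G a)) / N)"
  unfolding mean_counting_function_def eigenvalue_count_def[symmetric] erdos_renyi_eq_random_subset
  by (subst Bochner_Integration.integral_diff[symmetric])
     (auto intro!: integrable_random_subset finite_possible_edges simp: diff_divide_distrib)

text \<open>Exponential Markov inequality: a vertex whose component has size at least
  \<open>r = 1 / sqrt (2 * b)\<close> is counted with weight \<open>z ^ card * z powr (- r)\<close>,
  which is at least 1. The bound depends neither on \<open>a\<close> nor on \<open>N\<close>, so
  both limits can be taken.\<close>

lemma mean_counting_function_diff_le:
  assumes p: "0 < p" "p < 1" and N: "0 < N" and ab: "0 < a" "a \<le> b"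
  shows "mean_counting_function p N b - mean_counting_function p N a \<le>
     (1 / p) * (exp (p - 1) / p) powr (- (1 / sqrt (2 * b)))"
proof -
  define z where "z = exp (p - 1) / p"
  have z: "1 < z" using subcritical_growth_rate[OF p] by (simp add: z_def)
  define m where "m = z powr (- (1 / sqrt (2 * b)))"
  let ?F = "possible_edges N"
  have "mean_counting_function p N b - mean_counting_function p N a \<le>
      measure_pmf.expectation (random_subset (p / N) ?F) (\<lambda>G. \<Sum>x\<in>{1..N}. z ^ card (reach G {x}) * m / N)"
    unfolding mean_counting_function_diff erdos_renyi_eq_random_subset
  proof (rule expectation_random_subset_mono[OF finite_possible_edges])
    fix G assume G: "G \<subseteq> ?F"
    define B where "B = {x \<in> {1..N}. 1 \<le> 2 * b * (card (reach G {x}))\<^sup>2}"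
    have "real (card B) = (\<Sum>x\<in>B. 1)" by simp
    also have "\<dots> \<le> (\<Sum>x\<in>B. z ^ card (reach G {x}) * m)"
    proof (rule sum_mono)
      fix x assume "x \<in> B"
      then have "1 / (2 * b) \<le> (card (reach G {x}))\<^sup>2" using ab by (simp add: B_def field_simps)
      then have "sqrt (1 / (2 * b)) \<le> card (reach G {x})"
        by (metis of_nat_0_le_iff of_nat_power real_le_lsqrt real_sqrt_le_mono real_sqrt_abs abs_of_nat)
      then have "0 \<le> real (card (reach G {x})) + (- (1 / sqrt (2 * b)))" by (simp add: real_sqrt_divide)
      then have "1 \<le> z powr (real (card (reach G {x})) + (- (1 / sqrt (2 * b))))"
        using z by (intro ge_one_powr_ge_zero) auto
      also have "\<dots> = z ^ card (reach G {x}) * m"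
        using z unfolding m_def powr_add by (simp add: powr_realpow)
      finally show "1 \<le> z ^ card (reach G {x}) * m" .
    qed
    also have "\<dots> \<le> (\<Sum>x\<in>{1..N}. z ^ card (reach G {x}) * m)"
      using z by (intro sum_mono2) (auto simp: B_def m_def)
    finally have "real (eigenvalue_count N G b) - real (eigenvalue_count N G a) \<le> (\<Sum>x\<in>{1..N}. z ^ card (reach G {x}) * m)"
      using eigenvalue_count_diff_le[OF G ab] unfolding B_def by linarith
    then show "(real (eigenvalue_count N G b) - real (eigenvalue_count N G a)) / N \<le> (\<Sum>x\<in>{1..N}. z ^ card (reach G {x}) * m / N)"
      by (simp add: sum_divide_distrib[symmetric] divide_right_mono)
  qed
  also have "\<dots> = (\<Sum>x\<in>{1..N}. measure_pmf.expectation (random_subset (p / N) ?F) (\<lambda>G. z ^ card (reach G {x})) * m / N)"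
    by (subst Bochner_Integration.integral_sum) (auto intro!: integrable_random_subset finite_possible_edges)
  also have "\<dots> \<le> (\<Sum>x\<in>{1..N}. (1 / p) * m / N)"
    using expectation_power_component_le[OF p N] unfolding erdos_renyi_eq_random_subset z_def[symmetric]
    by (intro sum_mono divide_right_mono mult_right_mono) (auto simp: m_def)
  also have "\<dots> = (1 / p) * m" using N by simp
  finally show ?thesis by (simp add: m_def z_def)
qed

section \<open>Lower bound from isolated paths\<close>

text \<open>Read both paths from the common start: the next vertex of \<open>ys\<close> is a
  neighbour on \<open>xs\<close>, hence the successor or the predecessor there, and the latter would
  repeat an entry of \<open>ys\<close>. Thus paths of fixed length can be counted by their starting
  vertices.\<close>

lemma isolated_path_unique:
  assumes xs: "isolated_path G xs" and ys: "isolated_path G ys"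
    and len: "length xs = length ys" and hd: "hd xs = hd ys"
  shows "xs = ys"
proof (rule nth_equalityI[OF len])
  fix k assume "k < length xs"
  then show "xs ! k = ys ! k"
  proof (induction k rule: less_induct)
    case (less k)
    show ?case
    proof (cases k)
      case 0
      then show ?thesis using hd less.prems len by (metis hd_conv_nth length_greater_0_conv)
    next
      case (Suc m)
      have dist: "distinct ys" using ys by (simp add: isolated_path_def)
      have "{ys ! m, ys ! Suc m} \<in> G"
        using isolated_path_edge_iff[OF ys, of m] less.prems len Suc by auto
      then have "{xs ! m, ys ! Suc m} \<in> G" using less.IH[of m] less.prems Suc by simp
      then obtain j where j: "j < length xs" "ys ! Suc m = xs ! j" "j = Suc m \<or> m = Suc j"
        using isolated_path_edge_iff[OF xs, of m] less.prems Suc by auto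
      show ?thesis
      proof (cases "j = Suc m")
        case False
        then have "ys ! Suc m = ys ! j" using j less.IH[of j] less.prems Suc by simp
        then show ?thesis using dist j False less.prems Suc len by (auto simp: nth_eq_iff_index_eq)
      qed (use j Suc in simp)
    qed
  qed
qed

text \<open>By independence it suffices to require all path edges and to forbid all other edges
  touching the path. The exponent \<open>length xs * N\<close> is a crude count of the forbidden
  edges, each determined by a path vertex and a second endpoint.\<close>

lemma prob_isolated_path_ge:
  assumes q: "0 \<le> q" "q \<le> 1" and xs: "distinct xs" "set xs \<subseteq> {1..N}"
  shows "q ^ (length xs - 1) * (1 - q) ^ (length xs * N) \<le>
         measure_pmf.prob (random_subset q (possible_edges N)) {G. isolated_path G xs}"
proof -
  let ?F = "possible_edges N"
  define P where "P = path_edges xs"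
  define T where "T = {e \<in> ?F. e \<inter> set xs \<noteq> {}} - P"
  \<comment> \<open>The admissible states of each edge: present on the path, absent if it merely
    touches the path, unconstrained otherwise. The event becomes a product set.\<close>
  define B where "B e = (if e \<in> P then {True} else if e \<in> T then {False} else UNIV)" for e
  have PF: "P \<subseteq> ?F"
  proof
    fix e assume "e \<in> P"
    then obtain i where i: "e = {xs ! i, xs ! Suc i}" "Suc i < length xs" by (auto simp: P_def path_edges_def)
    moreover have "xs ! i \<noteq> xs ! Suc i" using xs i by (simp add: nth_eq_iff_index_eq)
    moreover have "xs ! i \<in> {1..N}" "xs ! Suc i \<in> {1..N}" using xs i nth_mem[of _ xs] Suc_lessD by blast+
    ultimately show "e \<in> ?F" by (simp add: possible_edges_def)
  qed
  have Pxs: "e \<inter> set xs \<noteq> {}" if "e \<in> P" for e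
    using that nth_mem[of _ xs] by (auto simp: P_def path_edges_def)
  have "P = (\<lambda>i. {xs ! i, xs ! Suc i}) ` {..<length xs - 1}" by (auto simp: P_def path_edges_def)
  then have cardP: "card P \<le> length xs - 1" using card_image_le[of "{..<length xs - 1}"] by simp
  have "T \<subseteq> (\<lambda>(v, t). {v, t}) ` (set xs \<times> {1..N})"
  proof
    fix e assume e: "e \<in> T"
    then obtain v where v: "v \<in> e" "v \<in> set xs" by (auto simp: T_def)
    have "card e = 2" "e \<subseteq> {1..N}" using e by (auto simp: T_def possible_edges_def)
    then obtain a c where "e = {a, c}" "a \<in> {1..N}" "c \<in> {1..N}" by (auto simp: card_2_iff)
    then have "e = {v, a} \<and> a \<in> {1..N} \<or> e = {v, c} \<and> c \<in> {1..N}" using v(1) by auto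
    then show "e \<in> (\<lambda>(v, t). {v, t}) ` (set xs \<times> {1..N})" using v(2) by blast
  qed
  then have "card T \<le> card (set xs \<times> {1..N})" by (rule surj_card_le[rotated]) auto
  then have cardT: "card T \<le> length xs * N" using distinct_card[OF xs(1)] by (simp add: card_cartesian_product)
  have "q ^ (length xs - 1) * (1 - q) ^ (length xs * N) \<le> q ^ card P * (1 - q) ^ card T"
    using q cardP cardT by (intro mult_mono power_decreasing) auto
  also have "\<dots> = (\<Prod>e\<in>?F. (if e \<in> P then q else 1) * (if e \<in> T then 1 - q else 1))"
  proof -
    have "?F \<inter> P = P" "?F \<inter> T = T" using PF by (auto simp: T_def)
    then show ?thesis using finite_possible_edges by (simp add: prod.distrib prod.If_cases Collect_mem_eq)
  qed
  also have "\<dots> = (\<Prod>e\<in>?F. measure_pmf.prob (bernoulli_pmf q) (B e))"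
    using q by (intro prod.cong refl) (auto simp: B_def T_def measure_pmf_single)
  also have "\<dots> = measure_pmf.prob (Pi_pmf ?F False (\<lambda>_. bernoulli_pmf q)) (Pi ?F B)"
    by (rule measure_Pi_pmf_Pi[symmetric, OF finite_possible_edges])
  also have "\<dots> \<le> measure_pmf.prob (Pi_pmf ?F False (\<lambda>_. bernoulli_pmf q))
      ((\<lambda>X. {e \<in> ?F. X e}) -` {G. isolated_path G xs})"
  proof (intro measure_pmf.finite_measure_mono subsetI)
    fix X assume X: "X \<in> Pi ?F B"
    have "{e \<in> {e \<in> ?F. X e}. e \<inter> set xs \<noteq> {}} = P"
    proof (intro equalityI subsetI)
      fix e assume e: "e \<in> {e \<in> {e \<in> ?F. X e}. e \<inter> set xs \<noteq> {}}"
      show "e \<in> P"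
      proof (rule ccontr)
        assume "e \<notin> P"
        moreover from this have "e \<in> T" using e by (auto simp: T_def)
        moreover have "X e \<in> B e" using e by (intro Pi_mem[OF X]) simp
        moreover have "X e" using e by simp
        ultimately show False by (simp add: B_def)
      qed
    next
      fix e assume e: "e \<in> P"
      moreover have "X e \<in> B e" using e X PF by auto
      ultimately have "X e" by (simp add: B_def)
      then show "e \<in> {e \<in> {e \<in> ?F. X e}. e \<inter> set xs \<noteq> {}}" using e PF Pxs by blast
    qed
    then show "X \<in> (\<lambda>X. {e \<in> ?F. X e}) -` {G. isolated_path G xs}"
      using xs(1) by (simp add: isolated_path_def P_def)
  qed auto
  finally show ?thesis by (simp add: random_subset_def)
qed

text \<open>Sum the probability bound over all lists of \<open>n\<close> distinct vertices. Their
  number is a falling factorial with \<open>n\<close> factors, each at least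
  \<open>N - n + 1\<close>, and \<open>hd\<close> is injective on the lists that are isolated paths
  in a given graph.\<close>

lemma expectation_isolated_path_starts_ge:
  assumes q: "0 \<le> q" "q \<le> 1" and n: "1 \<le> n" "n \<le> N"
  shows "real (N - n + 1) ^ n * (q ^ (n - 1) * (1 - q) ^ (n * N)) \<le>
     measure_pmf.expectation (random_subset q (possible_edges N))
       (\<lambda>G. real (card {x \<in> {1..N}. \<exists>xs. isolated_path G xs \<and> length xs = n \<and> hd xs = x}))"
proof -
  define L where "L = {xs. length xs = n \<and> distinct xs \<and> set xs \<subseteq> {1..N}}"
  have finL: "finite L" unfolding L_def by (rule finite_subset[OF _ finite_lists_length_eq[of "{1..N}" n]]) auto
  have "real (N - n + 1) ^ n = (\<Prod>i\<in>{N - n + 1..N}. real (N - n + 1))" using n by simp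
  also have "\<dots> \<le> (\<Prod>i\<in>{N - n + 1..N}. real i)" by (intro prod_mono) auto
  also have "\<dots> = real (card L)"
    unfolding L_def using card_lists_distinct_length_eq[of "{1..N}" n] n by simp
  finally have cardL: "real (N - n + 1) ^ n \<le> real (card L)" .
  have "real (N - n + 1) ^ n * (q ^ (n - 1) * (1 - q) ^ (n * N)) \<le> (\<Sum>xs\<in>L. q ^ (n - 1) * (1 - q) ^ (n * N))"
    using cardL q by (simp add: mult_right_mono)
  also have "\<dots> \<le> (\<Sum>xs\<in>L. measure_pmf.prob (random_subset q (possible_edges N)) {G. isolated_path G xs})"
    using prob_isolated_path_ge[OF q] by (intro sum_mono) (auto simp: L_def)
  also have "\<dots> = (\<Sum>xs\<in>L. measure_pmf.expectation (random_subset q (possible_edges N)) (indicator {G. isolated_path G xs}))"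
    by simp
  also have "\<dots> = measure_pmf.expectation (random_subset q (possible_edges N)) (\<lambda>G. \<Sum>xs\<in>L. indicator {G. isolated_path G xs} G)"
    by (rule Bochner_Integration.integral_sum[symmetric]) (intro integrable_random_subset finite_possible_edges)
  also have "\<dots> \<le> measure_pmf.expectation (random_subset q (possible_edges N))
       (\<lambda>G. real (card {x \<in> {1..N}. \<exists>xs. isolated_path G xs \<and> length xs = n \<and> hd xs = x}))"
  proof (rule expectation_random_subset_mono[OF finite_possible_edges])
    fix G :: "nat set set"
    have "(\<Sum>xs\<in>L. indicator {G. isolated_path G xs} G) = real (card {xs \<in> L. isolated_path G xs})"
      using finL by (simp add: indicator_def sum.If_cases Int_def)
    also have "card {xs \<in> L. isolated_path G xs} \<le> card {x \<in> {1..N}. \<exists>xs. isolated_path G xs \<and> length xs = n \<and> hd xs = x}"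
    proof (rule card_inj_on_le[of hd])
      show "inj_on hd {xs \<in> L. isolated_path G xs}"
        by (auto simp: inj_on_def L_def intro: isolated_path_unique)
      show "hd ` {xs \<in> L. isolated_path G xs} \<subseteq> {x \<in> {1..N}. \<exists>xs. isolated_path G xs \<and> length xs = n \<and> hd xs = x}"
      proof
        fix x assume "x \<in> hd ` {xs \<in> L. isolated_path G xs}"
        then obtain xs where xs: "xs \<in> L" "isolated_path G xs" "x = hd xs" by blast
        then have "xs \<noteq> []" using n by (auto simp: L_def)
        then have "x \<in> set xs" using xs by simp
        then have "x \<in> {1..N}" using xs by (auto simp: L_def)
        then show "x \<in> {x \<in> {1..N}. \<exists>xs. isolated_path G xs \<and> length xs = n \<and> hd xs = x}"
          using xs by (auto simp: L_def)
      qed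
    qed auto
    finally show "(\<Sum>xs\<in>L. indicator {G. isolated_path G xs} G) \<le>
        real (card {x \<in> {1..N}. \<exists>xs. isolated_path G xs \<and> length xs = n \<and> hd xs = x})" by simp
  qed
  finally show ?thesis .
qed

text \<open>For \<open>N\<close> at least \<open>2 * n\<close>, a path has at least
  \<open>N / 2\<close> choices per vertex, and \<open>N / 2 * q = p / 2\<close>; isolation costs at
  most a factor \<open>exp (- 2)\<close> per vertex. The bound no longer depends on
  \<open>N\<close>.\<close>

lemma mean_counting_function_diff_ge:
  assumes p: "0 < p" "p < 1" and n: "2 \<le> n" and N: "2 * n \<le> N"
    and ab: "a < 2 - 2 * cos (pi / n)" "2 - 2 * cos (pi / n) \<le> b"
  shows "(p / 2 * exp (- 2)) ^ n / (2 * real n) \<le> mean_counting_function p N b - mean_counting_function p N a"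
proof -
  define q where "q = p / real N"
  have N0: "0 < real N" using n N by simp
  have q: "0 \<le> q" "q \<le> 1" "q \<le> 1 / 2" "q * N = p"
    using p n N by (auto simp: q_def field_simps)
  have e: "exp (- 2) ^ n \<le> (1 - q) ^ (n * N)"
  proof -
    \<comment> \<open>As \<open>q\<close> is at most 1/2, \<open>2 * q\<^sup>2\<close> is at most
      \<open>q\<close>; this turns the quadratic lower bound for \<open>ln (1 - q)\<close> into a
      linear one.\<close>
    have "- 2 * q \<le> - q - 2 * q\<^sup>2" using mult_left_mono[OF q(3,1)] by (simp add: power2_eq_square)
    also have "\<dots> \<le> ln (1 - q)" using q by (intro ln_one_minus_pos_lower_bound) auto
    finally have "exp (- 2 * q) \<le> 1 - q" using q by (subst (asm) ln_ge_iff) auto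
    then have "exp (- 2 * q) ^ (n * N) \<le> (1 - q) ^ (n * N)" by (intro power_mono) auto
    moreover have "exp (- 2 * q) ^ (n * N) = exp (- 2 * p) ^ n"
      using q(4) by (simp add: exp_of_nat_mult[symmetric] mult_ac)
    moreover have "exp (- 2) ^ n \<le> exp (- 2 * p) ^ n" using p by (intro power_mono) auto
    ultimately show ?thesis by linarith
  qed
  have "(p / 2 * exp (- 2)) ^ n \<le> ((N / 2) ^ n * (q ^ (n - 1) * exp (- 2) ^ n)) / N"
  proof -
    obtain k where k: "n = Suc k" using n by (cases n) auto
    \<comment> \<open>A path has one vertex more than edges. The unmatched factor
      \<open>N / 2\<close> is cancelled by the division by \<open>N\<close> up to 1/2, which exceeds
      \<open>p / 2\<close>.\<close>
    have "(p / 2 * exp (- 2)) ^ n = (p / 2) * ((p / 2) ^ k * exp (- 2) ^ n)"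
      unfolding k by (simp only: power_mult_distrib power_Suc mult_ac)
    also have "\<dots> \<le> (1 / 2) * ((p / 2) ^ k * exp (- 2) ^ n)"
      using p by (intro mult_right_mono) auto
    also have "\<dots> = (1 / 2) * (((N / 2) * q) ^ k * exp (- 2) ^ n)"
      using q(4) by (simp add: mult.commute)
    also have "\<dots> = ((N / 2) ^ n * (q ^ (n - 1) * exp (- 2) ^ n)) / N"
      using N0 unfolding k power_mult_distrib by simp
    finally show ?thesis .
  qed
  also have "\<dots> \<le> (real (N - n + 1) ^ n * (q ^ (n - 1) * (1 - q) ^ (n * N))) / N"
    using N q e by (intro divide_right_mono mult_mono power_mono) (auto simp: of_nat_diff)
  also have "\<dots> \<le> measure_pmf.expectation (random_subset q (possible_edges N))
       (\<lambda>G. real (card {x \<in> {1..N}. \<exists>xs. isolated_path G xs \<and> length xs = n \<and> hd xs = x})) / N"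
    using q n N by (intro divide_right_mono expectation_isolated_path_starts_ge) auto
  finally have "(p / 2 * exp (- 2)) ^ n / (2 * real n) \<le> measure_pmf.expectation (random_subset q (possible_edges N))
       (\<lambda>G. real (card {x \<in> {1..N}. \<exists>xs. isolated_path G xs \<and> length xs = n \<and> hd xs = x})) / N / (2 * real n)"
    by (rule divide_right_mono) simp
  also have "\<dots> = measure_pmf.expectation (random_subset q (possible_edges N))
       (\<lambda>G. real (card {x \<in> {1..N}. \<exists>xs. isolated_path G xs \<and> length xs = n \<and> hd xs = x}) / (2 * real n) / N)"
    by simp
  also have "\<dots> \<le> measure_pmf.expectation (random_subset q (possible_edges N))
     (\<lambda>G. (real (eigenvalue_count N G b) - real (eigenvalue_count N G a)) / N)"
    by (intro expectation_random_subset_mono[OF finite_possible_edges] divide_right_mono eigenvalue_count_diff_ge[OF _ n ab]) auto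
  finally show ?thesis unfolding mean_counting_function_diff erdos_renyi_eq_random_subset q_def .
qed

section \<open>Passage to the limit\<close>

text \<open>Near zero \<open>\<bar>ln (g E)\<bar>\<close> lies between \<open>B / 2 / sqrt E\<close>
  and \<open>A / sqrt E\<close>. Taking logarithms and dividing by the negative \<open>ln E\<close>
  reverses the order, so \<open>A\<close> yields the lower and \<open>B / 2\<close> the upper
  comparison function.\<close>

lemma double_log_tail_limit:
  fixes g :: "real \<Rightarrow> real"
  assumes A: "0 < A" and B: "0 < B" and c: "0 < c"
    and lower: "\<And>E. 0 < E \<Longrightarrow> E \<le> 1 \<Longrightarrow> exp (- (A / sqrt E)) \<le> g E"
    and upper: "\<And>E. 0 < E \<Longrightarrow> g E \<le> c * exp (- (B / sqrt E))"
  shows "((\<lambda>E. ln \<bar>ln (g E)\<bar> / ln E) \<longlongrightarrow> - 1 / 2) (at_right 0)"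
proof -
  have ln_bot: "filterlim ln at_infinity (at_right (0::real))"
    by (rule filterlim_at_bot_imp_at_infinity[OF ln_at_0])
  have lim: "((\<lambda>E. ln K / ln E - 1 / 2) \<longlongrightarrow> - 1 / 2) (at_right 0)" for K :: real
    using tendsto_diff[OF tendsto_divide_0[OF tendsto_const[of "ln K"] ln_bot] tendsto_const[of "1 / 2"]]
    by simp
  \<comment> \<open>Below this threshold \<open>\<bar>ln c\<bar>\<close> is less than
    \<open>B / 2 / sqrt E\<close>, so the prefactor \<open>c\<close> uses up at most half of the
    exponent.\<close>
  define d where "d = min 1 ((B / (2 * (\<bar>ln c\<bar> + 1)))\<^sup>2)"
  have d: "0 < d" "d \<le> 1" using B by (auto simp: d_def)
  have "eventually (\<lambda>E. E \<in> {0<..<d}) (at_right 0)"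
    using d by (intro eventually_at_right_real) auto
  then have ev: "eventually (\<lambda>E. ln A / ln E - 1 / 2 \<le> ln \<bar>ln (g E)\<bar> / ln E \<and>
      ln \<bar>ln (g E)\<bar> / ln E \<le> ln (B / 2) / ln E - 1 / 2) (at_right 0)"
  proof eventually_elim
    case (elim E)
    then have E: "0 < E" "E < 1" "E < (B / (2 * (\<bar>ln c\<bar> + 1)))\<^sup>2" using d by (auto simp: d_def)
    have lnE: "ln E < 0" using E by simp
    have "sqrt E < B / (2 * (\<bar>ln c\<bar> + 1))"
      using E B by (intro real_less_lsqrt) auto
    then have "(\<bar>ln c\<bar> + 1) * (2 * sqrt E) < B"
      using pos_less_divide_eq[of "2 * (\<bar>ln c\<bar> + 1)" "sqrt E" B] by (simp add: mult_ac)
    then have cB: "\<bar>ln c\<bar> < B / 2 / sqrt E"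
      using E by (simp add: field_simps) (smt (verit) real_sqrt_gt_zero)
    have g0: "0 < g E" using lower[of E] E by (intro less_le_trans[OF exp_gt_zero]) auto
    have "- (A / sqrt E) \<le> ln (g E)"
      using lower[of E] E g0 by (simp add: ln_ge_iff)
    moreover have "ln (g E) \<le> ln (c * exp (- (B / sqrt E)))"
      using upper[of E] E g0 by simp
    moreover have "ln (c * exp (- (B / sqrt E))) = ln c - B / sqrt E"
      using c by (simp add: ln_mult)
    moreover have "B / sqrt E = B / 2 / sqrt E + B / 2 / sqrt E" by (simp add: field_simps)
    moreover have pos: "0 < B / 2 / sqrt E" using B E by simp
    ultimately have *: "B / 2 / sqrt E \<le> \<bar>ln (g E)\<bar>" "\<bar>ln (g E)\<bar> \<le> A / sqrt E" using cB by linarith+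
    have lnq: "ln (K / sqrt E) = ln K - ln E / 2" if "0 < K" for K
      using that E by (simp add: ln_div ln_sqrt)
    have "ln (B / 2) - ln E / 2 \<le> ln \<bar>ln (g E)\<bar>"
      using *(1) pos lnq[of "B / 2"] B ln_mono[of "B / 2 / sqrt E" "\<bar>ln (g E)\<bar>"] by linarith
    moreover have "ln \<bar>ln (g E)\<bar> \<le> ln A - ln E / 2"
      using * pos lnq[of A] A ln_mono[of "\<bar>ln (g E)\<bar>" "A / sqrt E"] by linarith
    moreover have "(ln K - ln E / 2) / ln E = ln K / ln E - 1 / 2" for K
      using lnE by (simp add: diff_divide_distrib)
    ultimately show ?case using lnE divide_right_mono_neg by (metis less_imp_le)
  qed
  show ?thesis
    by (rule tendsto_sandwich[OF _ _ lim[of A] lim[of "B / 2"]]) (use ev in \<open>auto elim: eventually_mono\<close>)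
qed

text \<open>A monotone function has only countably many discontinuities. Weak convergence gives
  information at continuity points only, so all energies are first moved to such points.\<close>

lemma mono_continuity_point:
  fixes f :: "real \<Rightarrow> real"
  assumes "mono f" "a < b"
  obtains x where "a < x" "x < b" "isCont f x"
  using open_minus_countable[OF mono_ctble_discont[OF assms(1)], of "{a<..<b}"] assms(2) by auto

text \<open>Compare at continuity points \<open>b\<close> in \<open>(E, 2 * E)\<close> and
  \<open>a > 0\<close>, let \<open>N\<close> grow, then let \<open>a\<close> decrease to 0 by
  right-continuity of \<open>\<sigma>\<close>. Replacing \<open>b\<close> by \<open>2 * E\<close> in
  the exponent produces the factor 1/2 in the rate.\<close>

lemma integrated_density_of_states_upper:
  assumes p: "0 < p" "p < 1" and ids: "integrated_density_of_states p \<sigma>" and E: "0 < E"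
  shows "\<sigma> E - \<sigma> 0 \<le> (1 / p) * exp (- (ln (exp (p - 1) / p) / 2 / sqrt E))"
proof -
  obtain M where M: "real_distribution M" "\<sigma> = cdf M" using ids by (auto simp: integrated_density_of_states_def)
  interpret real_distribution M by fact
  have mono: "mono \<sigma>" unfolding M(2) by (intro monoI cdf_nondecreasing)
  have conv: "(\<lambda>N. mean_counting_function p N x) \<longlonglongrightarrow> \<sigma> x" if "isCont \<sigma> x" for x
    using ids that by (auto simp: integrated_density_of_states_def weak_conv_def)
  define z where "z = exp (p - 1) / p"
  have z: "1 < z" using subcritical_growth_rate[OF p] by (simp add: z_def)
  define K where "K = (1 / p) * z powr (- (1 / sqrt (2 * (2 * E))))"
  obtain b where b: "E < b" "b < 2 * E" "isCont \<sigma> b" using mono_continuity_point[OF mono, of E "2 * E"] E by auto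
  have cont: "\<sigma> E - K \<le> \<sigma> a" if a: "0 < a" "a < E" "isCont \<sigma> a" for a
  proof -
    have "\<sigma> b - \<sigma> a \<le> K"
    proof (rule LIMSEQ_le_const2[OF tendsto_diff[OF conv[OF b(3)] conv[OF a(3)]]], intro exI allI impI)
      fix N :: nat assume "1 \<le> N"
      then have "mean_counting_function p N b - mean_counting_function p N a \<le> (1 / p) * z powr (- (1 / sqrt (2 * b)))"
        unfolding z_def using a b by (intro mean_counting_function_diff_le[OF p]) auto
      also have "\<dots> \<le> K"
      proof -
        have "1 / sqrt (2 * (2 * E)) \<le> 1 / sqrt (2 * b)" using b E by (intro divide_left_mono) auto
        then show ?thesis unfolding K_def using z p by (intro mult_left_mono powr_mono) auto
      qed
      finally show "mean_counting_function p N b - mean_counting_function p N a \<le> K" .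
    qed
    then show ?thesis using monoD[OF mono, of E b] b by simp
  qed
  have "eventually (\<lambda>e. e \<in> {0<..<E}) (at_right 0)" using E by (intro eventually_at_right_real) auto
  then have "eventually (\<lambda>e. \<sigma> E - K \<le> \<sigma> e) (at_right 0)"
  proof eventually_elim
    case (elim e)
    then obtain a where a: "0 < a" "a < e" "isCont \<sigma> a" using mono_continuity_point[OF mono, of 0 e] by auto
    then show ?case using cont[of a] elim monoD[OF mono, of a e] by auto
  qed
  moreover have "(\<sigma> \<longlongrightarrow> \<sigma> 0) (at_right 0)"
    unfolding M(2) using cdf_is_right_cont[of 0] by (simp add: continuous_within)
  ultimately have "\<sigma> E - K \<le> \<sigma> 0" by (intro tendsto_lowerbound) auto
  moreover have "K = (1 / p) * exp (- (ln z / 2 / sqrt E))"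
    using z E by (simp add: K_def powr_def real_sqrt_mult)
  ultimately show ?thesis unfolding z_def by simp
qed

text \<open>A path slightly longer than \<open>pi / sqrt E\<close> has its lowest positive
  eigenvalue below \<open>E\<close>. The eigenvalue is bracketed by continuity points
  \<open>a\<close> and \<open>b\<close> with \<open>0 < a\<close> and \<open>b < E\<close>, and
  monotonicity of \<open>\<sigma>\<close> extends the bound to
  \<open>\<sigma> E - \<sigma> 0\<close>.\<close>

lemma integrated_density_of_states_lower:
  assumes p: "0 < p" "p < 1" and ids: "integrated_density_of_states p \<sigma>" and E: "0 < E" "E \<le> 1"
  shows "exp (- (6 * (3 - ln (p / 2)) / sqrt E)) \<le> \<sigma> E - \<sigma> 0"
proof -
  obtain M where M: "real_distribution M" "\<sigma> = cdf M" using ids by (auto simp: integrated_density_of_states_def)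
  interpret real_distribution M by fact
  have mono: "mono \<sigma>" unfolding M(2) by (intro monoI cdf_nondecreasing)
  have conv: "(\<lambda>N. mean_counting_function p N x) \<longlonglongrightarrow> \<sigma> x" if "isCont \<sigma> x" for x
    using ids that by (auto simp: integrated_density_of_states_def weak_conv_def)
  \<comment> \<open>The added 1 makes \<open>n\<close> strictly larger than
    \<open>pi / sqrt E\<close>, leaving room for \<open>b\<close> below \<open>E\<close>. Since
    \<open>E\<close> is at most 1, rounding costs at most \<open>2 / sqrt E\<close>, and
    \<open>pi + 2 < 6\<close> gives the constant 6.\<close>
  define n where "n = nat \<lceil>pi / sqrt E\<rceil> + 1"
  have sE: "0 < sqrt E" "sqrt E \<le> 1" using E by auto
  have "pi \<le> pi / sqrt E" using sE pi_gt_zero by (simp add: field_simps)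
  then have p2: "2 < pi / sqrt E" using pi_gt3 by linarith
  have n1: "pi / sqrt E < n" unfolding n_def using p2 by linarith
  then have n2: "2 \<le> n" using p2 by linarith
  have "real n \<le> pi / sqrt E + 2" unfolding n_def using p2 by linarith
  also have "\<dots> \<le> (pi + 2) / sqrt E" using sE by (simp add: field_simps)
  also have "\<dots> \<le> 6 / sqrt E" using sE pi_less_4 by (intro divide_right_mono) auto
  finally have n6: "real n \<le> 6 / sqrt E" .
  have "pi / n < sqrt E" using n1 n2 sE by (simp add: field_simps)
  then have "(pi / n)\<^sup>2 < (sqrt E)\<^sup>2" by (intro power_strict_mono) auto
  then have piE: "(pi / n)\<^sup>2 < E" using E by simp
  note mu = two_minus_two_cos_bounds[OF n2]
  obtain b where b: "(pi / n)\<^sup>2 < b" "b < E" "isCont \<sigma> b" using mono_continuity_point[OF mono piE] by auto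
  obtain a where a: "0 < a" "a < 2 - 2 * cos (pi / n)" "isCont \<sigma> a" using mono_continuity_point[OF mono mu(1)] by auto
  have "(p / 2 * exp (- 2)) ^ n / (2 * real n) \<le> \<sigma> b - \<sigma> a"
  proof (rule LIMSEQ_le_const[OF tendsto_diff[OF conv[OF b(3)] conv[OF a(3)]]], intro exI allI impI)
    fix N assume "2 * n \<le> N"
    then show "(p / 2 * exp (- 2)) ^ n / (2 * real n) \<le> mean_counting_function p N b - mean_counting_function p N a"
      using a b mu by (intro mean_counting_function_diff_ge[OF p n2]) auto
  qed
  also have "\<dots> \<le> \<sigma> E - \<sigma> 0"
    using monoD[OF mono, of b E] monoD[OF mono, of 0 a] a b by simp
  finally have *: "(p / 2 * exp (- 2)) ^ n / (2 * real n) \<le> \<sigma> E - \<sigma> 0" .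
  have "ln (p / 2) < 0" using p by (intro ln_less_zero) auto
  then have kappa: "0 \<le> 3 - ln (p / 2)" by linarith
  \<comment> \<open>The polynomial loss \<open>1 / (2 * n)\<close> is absorbed by a further factor
    \<open>exp (- 1) ^ n\<close>. With \<open>exp (- 2)\<close> from isolation this accounts for the
    3 in the rate.\<close>
  have "2 * n \<le> 2 ^ n"
  proof -
    obtain k where k: "n = Suc k" using n2 by (cases n) auto
    have "Suc j \<le> 2 ^ j" for j :: nat by (induction j) auto
    from this[of k] show ?thesis unfolding k power_Suc by (rule mult_le_mono2)
  qed
  then have "real (2 * n) \<le> real (2 ^ n)" by (rule of_nat_mono)
  then have "2 * real n \<le> 2 ^ n" by simp
  also have "(2::real) ^ n \<le> exp 1 ^ n" using exp_ge_add_one_self[of 1] by (intro power_mono) auto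
  finally have "exp (-1) ^ n \<le> 1 / (2 * real n)"
    using n2 by (simp add: exp_minus power_inverse[symmetric] inverse_eq_divide power_divide divide_left_mono)
  then have **: "(p / 2 * exp (- 2)) ^ n * exp (-1) ^ n \<le> (p / 2 * exp (- 2)) ^ n * (1 / (2 * real n))"
    using p by (intro mult_left_mono) auto
  have "exp (- (6 * k / sqrt E)) \<le> exp (- k * n)" if "0 \<le> k" for k
    using mult_right_mono[OF n6 that] by (simp add: mult_ac)
  from this[OF kappa] have "exp (- (6 * (3 - ln (p / 2)) / sqrt E)) \<le> exp (- (3 - ln (p / 2)) * n)" .
  also have "\<dots> = exp (- (3 - ln (p / 2))) ^ n" by (rule exp_of_nat2_mult)
  also have "exp (- (3 - ln (p / 2))) = exp (ln (p / 2)) * exp (- 2) * exp (- 1)"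
    unfolding exp_add[symmetric] by simp
  also have "\<dots> = p / 2 * exp (- 2) * exp (- 1)" using p by simp
  also have "\<dots> ^ n = (p / 2 * exp (- 2)) ^ n * exp (-1) ^ n" by (rule power_mult_distrib)
  also note **
  also have "(p / 2 * exp (- 2)) ^ n * (1 / (2 * real n)) = (p / 2 * exp (- 2)) ^ n / (2 * real n)" by simp
  also note *
  finally show ?thesis .
qed

theorem theorem2p5:
  fixes p :: real and \<sigma> :: "real \<Rightarrow> real"
  assumes "0 < p" and "p < 1"
    and "integrated_density_of_states p \<sigma>"
  shows "((\<lambda>E. ln \<bar>ln (\<sigma> E - \<sigma> 0)\<bar> / ln E) \<longlongrightarrow> - 1 / 2) (at_right 0)"
proof (rule double_log_tail_limit)
  have "ln (p / 2) < 0" using assms by (intro ln_less_zero) auto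
  then show "0 < 6 * (3 - ln (p / 2))" by (intro mult_pos_pos) simp_all
  show "0 < ln (exp (p - 1) / p) / 2" using subcritical_growth_rate[OF assms(1,2)] by simp
  show "0 < 1 / p" using assms by simp
qed (use assms integrated_density_of_states_lower integrated_density_of_states_upper in auto)

end
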